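(* Let $\mathcal{A}$ be a finite alphabet with at least two elements. Let $G$ be a $G_\delta$ subset of $[0,1]$ which contains $1$. Then there exists $F\in\mathcal{C}(\mathcal{A}^{\mathbb{N}})$ such that $\mathrm{Uni}(F)=G$. Moreover, the set $$\left\{F\in\mathcal{C}(\mathcal{A}^{\mathbb{N}}):\mathrm{Uni}(F)=G\setminus\{0\}\right\}$$ is dense in $(\mathcal{C}(\mathcal{A}^{\mathbb{N}}),d_\infty)$. Furthermore, the set $$\left\{F\in\mathcal{C}(\mathcal{A}^{\mathbb{N}}):\mathrm{Uni}(F)=\,]0,1]\right\}$$ is generic in $(\mathcal{C}(\mathcal{A}^{\mathbb{N}}),d_\infty)$.
   Context: $\mathbb{N}=\{0,1,2,\dots\}$. For a finite alphabet $\mathcal{A}$, $\mathcal{A}^{\mathbb{N}}$ carries the product topology, induced by the distance $d(x,y)=2^{-\min\{n\,:\,x_{\{0,\dots,n\}}\neq y_{\{0,\dots,n\}}\}}$ for $x\ne y$ (and $d(x,x)=0$), and its Borel $\sigma$-algebra. $\mathcal{C}(\mathcal{A}^{\mathbb{N}})$ is the set of continuous functions $F:\mathcal{A}^{\mathbb{N}}\to\mathcal{A}^{\mathbb{N}}$, with distance $d_\infty(F,F')=\sup_{x\in\mathcal{A}^{\mathbb{N}}}d(F(x),F'(x))$. For $F\in\mathcal{C}(\mathcal{A}^{\mathbb{N}})$ and $\epsilon\in[0,1]$, the computer perturbation $F_\epsilon$ of size $\epsilon$ is the probability kernel on $\mathcal{A}^{\mathbb{N}}$ such that for all $x\in\mathcal{A}^{\mathbb{N}}$,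 all finite $U\subset\mathbb{N}$ and all $\omega\in\mathcal{A}^U$, $$F_\epsilon(x,[\omega]_U)=\prod_{i\in U}\left((1-\epsilon)\mathbf{1}_{\omega_i=F(x)_i}+\frac{\epsilon}{|\mathcal{A}|}\right),\qquad [\omega]_U=\{y\in\mathcal{A}^{\mathbb{N}}: y_U=\omega\}.$$ It acts on Borel probability measures by $F_\epsilon\mu(A)=\int F_\epsilon(x,A)\,d\mu(x)$; $\mu$ is $F_\epsilon$-invariant if $F_\epsilon\mu=\mu$. $\mathrm{Uni}(F)$ denotes the set of $\epsilon\in[0,1]$ such that $F_\epsilon$ admits a unique invariant probability measure. A $G_\delta$ set is a countable intersection of open sets (here relative to $[0,1]$ for $G$). A subset of $\mathcal{C}(\mathcal{A}^{\mathbb{N}})$ is generic if it contains a dense $G_\delta$ set. *)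

theory Defs
  imports "HOL-Probability.Probability"
begin

text \<open>
  The alphabet is a type of class \<open>finite\<close> carrying the discrete topology, and the
  configuration space is the type \<open>nat \<Rightarrow> 'a\<close>. Its library topology is the product
  topology, so \<open>continuous_on\<close> and \<open>borel\<close> have the intended meaning on it.
\<close>

section \<open>Metrics on the configuration space and on its continuous self-maps\<close>

definition config_dist :: "(nat \<Rightarrow> 'a) \<Rightarrow> (nat \<Rightarrow> 'a) \<Rightarrow> real" where
  "config_dist x y =
     (if x = y then 0 else 1 / 2 ^ (LEAST n. restrict x {0..n} \<noteq> restrict y {0..n}))"

definition continuous_maps ::
    "((nat \<Rightarrow> 'a::{finite, discrete_topology}) \<Rightarrow> (nat \<Rightarrow> 'a)) set" where
  "continuous_maps = {F. continuous_on UNIV F}"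

definition map_dist :: "((nat \<Rightarrow> 'a) \<Rightarrow> (nat \<Rightarrow> 'a)) \<Rightarrow> ((nat \<Rightarrow> 'a) \<Rightarrow> (nat \<Rightarrow> 'a)) \<Rightarrow> real" where
  "map_dist F F' = (SUP x. config_dist (F x) (F' x))"

definition continuous_maps_topology ::
    "((nat \<Rightarrow> 'a::{finite, discrete_topology}) \<Rightarrow> (nat \<Rightarrow> 'a)) topology" where
  "continuous_maps_topology = Metric_space.mtopology continuous_maps map_dist"

definition dense_in :: "'b topology \<Rightarrow> 'b set \<Rightarrow> bool" where
  "dense_in X S \<longleftrightarrow> S \<subseteq> topspace X \<and> X closure_of S = topspace X"

definition generic_in :: "'b topology \<Rightarrow> 'b set \<Rightarrow> bool" where
  "generic_in X S \<longleftrightarrow> S \<subseteq> topspace X \<and> (\<exists>D \<subseteq> S. gdelta_in X D \<and> dense_in X D)"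

section \<open>Computer perturbations\<close>

text \<open>Only the values of \<open>\<omega>\<close> on \<open>U\<close> matter.\<close>

definition cylinder :: "nat set \<Rightarrow> (nat \<Rightarrow> 'a) \<Rightarrow> (nat \<Rightarrow> 'a) set" where
  "cylinder U \<omega> = {y. \<forall>i\<in>U. y i = \<omega> i}"

definition is_computer_perturbation ::
    "((nat \<Rightarrow> 'a::{finite, discrete_topology}) \<Rightarrow> (nat \<Rightarrow> 'a)) \<Rightarrow> real \<Rightarrow>
     ((nat \<Rightarrow> 'a) \<Rightarrow> (nat \<Rightarrow> 'a) measure) \<Rightarrow> bool" where
  "is_computer_perturbation F \<epsilon> K \<longleftrightarrow>
     K \<in> borel \<rightarrow>\<^sub>M prob_algebra borel \<and>
     (\<forall>x U \<omega>. finite U \<longrightarrow>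
        measure (K x) (cylinder U \<omega>) =
          (\<Prod>i\<in>U. (1 - \<epsilon>) * of_bool (\<omega> i = F x i) + \<epsilon> / real CARD('a)))"

text \<open>
  The description is proved below to be proper (lemma \<open>ex1_computer_perturbation\<close>)
  for continuous \<open>F\<close> and \<open>\<epsilon> \<in> {0..1}\<close>.
\<close>

definition computer_perturbation ::
    "((nat \<Rightarrow> 'a::{finite, discrete_topology}) \<Rightarrow> (nat \<Rightarrow> 'a)) \<Rightarrow> real \<Rightarrow>
     (nat \<Rightarrow> 'a) \<Rightarrow> (nat \<Rightarrow> 'a) measure" where
  "computer_perturbation F \<epsilon> = (THE K. is_computer_perturbation F \<epsilon> K)"

text \<open>The action of a kernel \<open>K\<close> on a measure \<open>\<mu>\<close> is the Giry bind; see \<open>emeasure_kernel_action\<close>.\<close>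

definition invariant_measure ::
    "((nat \<Rightarrow> 'a::{finite, discrete_topology}) \<Rightarrow> (nat \<Rightarrow> 'a) measure) \<Rightarrow>
     (nat \<Rightarrow> 'a) measure \<Rightarrow> bool" where
  "invariant_measure K \<mu> \<longleftrightarrow> \<mu> \<in> space (prob_algebra borel) \<and> \<mu> \<bind> K = \<mu>"

definition Uni :: "((nat \<Rightarrow> 'a::{finite, discrete_topology}) \<Rightarrow> (nat \<Rightarrow> 'a)) \<Rightarrow> real set" where
  "Uni F = {\<epsilon> \<in> {0..1}. \<exists>!\<mu>. invariant_measure (computer_perturbation F \<epsilon>) \<mu>}"

section \<open>Well-definedness\<close>

lemma restrict_neq_iff: "restrict x {0..n} \<noteq> restrict y {0..n::nat} \<longleftrightarrow> (\<exists>i\<le>n. x i \<noteq> y i)"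
  by (auto simp: restrict_def fun_eq_iff)

lemma config_dist_less_iff:
  "config_dist x y < 1 / 2 ^ n \<longleftrightarrow> (\<forall>i\<le>n. x i = y i)"
proof (cases "x = y")
  case False
  define m where "m = (LEAST n. restrict x {0..n} \<noteq> restrict y {0..n})"
  from False obtain k where "x k \<noteq> y k" by auto
  then have "\<exists>n. restrict x {0..n} \<noteq> restrict y {0..n}"
    unfolding restrict_neq_iff by blast
  then have 1: "restrict x {0..m} \<noteq> restrict y {0..m}"
    unfolding m_def by (rule LeastI_ex)
  have 2: "m \<le> k" if "restrict x {0..k} \<noteq> restrict y {0..k}" for k
    unfolding m_def using that by (rule Least_le)
  have "(\<forall>i\<le>n. x i = y i) \<longleftrightarrow> n < m"
    using 1 2[of n] unfolding restrict_neq_iff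
    by (metis le_trans linorder_not_le)
  moreover have "config_dist x y = 1 / 2 ^ m"
    using False by (simp add: config_dist_def m_def)
  moreover have "1 / 2 ^ m < (1 / 2 ^ n :: real) \<longleftrightarrow> n < m"
    by (simp add: divide_simps)
  ultimately show ?thesis
    by simp
qed (simp add: config_dist_def)

lemma config_dist_nonneg: "0 \<le> config_dist x y"
  by (simp add: config_dist_def)

lemma config_dist_le_1: "config_dist x y \<le> 1"
  by (simp add: config_dist_def)

lemma config_dist_commute: "config_dist x y = config_dist y x"
proof (cases "x = y")
  case False
  have "(\<lambda>n. restrict x {0..n} \<noteq> restrict y {0..n}) = (\<lambda>n. restrict y {0..n} \<noteq> restrict x {0..n})"
    by (rule ext) (rule neq_commute)
  then have L: "(LEAST n. restrict x {0..n} \<noteq> restrict y {0..n}) =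
      (LEAST n. restrict y {0..n} \<noteq> restrict x {0..n})"
    by (rule arg_cong)
  have "y \<noteq> x" using False by (rule not_sym)
  show ?thesis
    unfolding config_dist_def if_not_P[OF False] if_not_P[OF \<open>y \<noteq> x\<close>] L by (rule refl)
qed (rule arg_cong2[where f = config_dist], simp_all)

lemma config_dist_eq_0: "config_dist x y = 0 \<longleftrightarrow> x = y"
  by (simp add: config_dist_def)

lemma config_dist_ultra: "config_dist x z \<le> max (config_dist x y) (config_dist y z)"
proof (rule ccontr)
  assume *: "\<not> ?thesis"
  then have "x \<noteq> z"
    using config_dist_nonneg[of x y] by (auto simp: config_dist_def)
  then obtain n where n: "config_dist x z = 1 / 2 ^ n"
    by (auto simp: config_dist_def)
  with * have "config_dist x y < 1 / 2 ^ n" "config_dist y z < 1 / 2 ^ n"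
    by auto
  then have "config_dist x z < 1 / 2 ^ n"
    unfolding config_dist_less_iff by auto
  with n show False by simp
qed

lemma Metric_space_config: "Metric_space UNIV config_dist"
proof
  show "config_dist x z \<le> config_dist x y + config_dist y z" for x y z :: "nat \<Rightarrow> 'a"
    using config_dist_ultra[of x z y] config_dist_nonneg[of x y] config_dist_nonneg[of y z] by linarith
qed (rule config_dist_nonneg config_dist_commute config_dist_eq_0)+

lemma bdd_above_config_dist: "bdd_above (range (\<lambda>x. config_dist (F x) (F' x)))"
  by (rule bdd_aboveI2[where M = 1]) (rule config_dist_le_1)

lemma config_dist_le_map_dist: "config_dist (F x) (F' x) \<le> map_dist F F'"
  unfolding map_dist_def by (rule cSUP_upper[OF _ bdd_above_config_dist]) simp

lemma Metric_space_maps: "Metric_space S map_dist"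
proof
  show nn: "0 \<le> map_dist F F'" for F F' :: "(nat \<Rightarrow> 'a) \<Rightarrow> (nat \<Rightarrow> 'a)"
    using config_dist_le_map_dist[of F undefined F'] config_dist_nonneg order_trans by blast
  show "map_dist F F' = map_dist F' F" for F F' :: "(nat \<Rightarrow> 'a) \<Rightarrow> (nat \<Rightarrow> 'a)"
    unfolding map_dist_def by (simp only: config_dist_commute[of "F _" "F' _"])
  show "map_dist F F' = 0 \<longleftrightarrow> F = F'" for F F' :: "(nat \<Rightarrow> 'a) \<Rightarrow> (nat \<Rightarrow> 'a)"
  proof
    assume "map_dist F F' = 0"
    then have "config_dist (F x) (F' x) = 0" for x
      using config_dist_le_map_dist[of F x F'] config_dist_nonneg[of "F x" "F' x"] by linarith
    then show "F = F'" by (auto simp: config_dist_eq_0)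
  qed (simp add: map_dist_def config_dist_def)
  show "map_dist F H \<le> map_dist F E + map_dist E H" for F E H :: "(nat \<Rightarrow> 'a) \<Rightarrow> (nat \<Rightarrow> 'a)"
    unfolding map_dist_def[of F H]
  proof (rule cSUP_least)
    fix x
    show "config_dist (F x) (H x) \<le> map_dist F E + map_dist E H"
      using Metric_space.triangle[OF Metric_space_config, of "F x" "E x" "H x"]
        config_dist_le_map_dist[of F x E] config_dist_le_map_dist[of E x H] by simp
  qed simp
qed

lemma topspace_continuous_maps_topology [simp]:
  "topspace continuous_maps_topology = continuous_maps"
  unfolding continuous_maps_topology_def
  by (rule Metric_space.topspace_mtopology[OF Metric_space_maps])

lemma open_cylinder:
  fixes \<omega> :: "nat \<Rightarrow> 'a::discrete_topology"
  assumes "finite U"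
  shows "open (cylinder U \<omega>)"
proof -
  have "cylinder U \<omega> = {f. \<forall>i\<in>U. f (id i) \<in> {\<omega> i}}"
    by (auto simp: cylinder_def)
  also have "open \<dots>"
    using assms by (rule product_topology_basis') (rule Topological_Spaces.open_discrete)
  finally show ?thesis .
qed

lemma open_contains_cylinder:
  fixes S :: "(nat \<Rightarrow> 'a::discrete_topology) set"
  assumes "open S" "x \<in> S"
  shows "\<exists>n. cylinder {..n} x \<subseteq> S"
proof -
  have "openin (product_topology (\<lambda>i. euclidean) UNIV) S"
    using assms(1) unfolding open_fun_def .
  from product_topology_open_contains_basis[OF this assms(2)]
  obtain X where X: "x \<in> (\<Pi>\<^sub>E i\<in>UNIV. X i)" "finite {i. X i \<noteq> UNIV}" "(\<Pi>\<^sub>E i\<in>UNIV. X i) \<subseteq> S"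
    by auto
  from X(2) obtain n where n: "{i. X i \<noteq> UNIV} \<subseteq> {..n}"
    using finite_nat_iff_bounded_le by auto
  have "cylinder {..n} x \<subseteq> (\<Pi>\<^sub>E i\<in>UNIV. X i)"
  proof
    fix y assume y: "y \<in> cylinder {..n} x"
    have "y i \<in> X i" for i
    proof (cases "i \<le> n")
      case True
      then show ?thesis using y X(1) by (auto simp: cylinder_def)
    next
      case False
      then have "X i = UNIV" using n by auto
      then show ?thesis by simp
    qed
    then show "y \<in> (\<Pi>\<^sub>E i\<in>UNIV. X i)" by auto
  qed
  with X(3) show ?thesis by blast
qed

lemma mtopology_config_dist:
  "Metric_space.mtopology UNIV config_dist =
     (euclidean :: (nat \<Rightarrow> 'a::discrete_topology) topology)"
proof -
  interpret Metric_space UNIV "config_dist :: (nat \<Rightarrow> 'a) \<Rightarrow> _"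
    by (rule Metric_space_config)
  have ball: "mball x (1 / 2 ^ n) = cylinder {..n} x" for x :: "nat \<Rightarrow> 'a" and n
    by (auto simp: mball_def config_dist_less_iff cylinder_def)
  show ?thesis
  proof (rule topology_eq[THEN iffD2], intro allI iffI)
    fix S :: "(nat \<Rightarrow> 'a) set"
    assume S: "openin mtopology S"
    have "\<exists>T. open T \<and> x \<in> T \<and> T \<subseteq> S" if "x \<in> S" for x
    proof -
      from S that obtain r where r: "r > 0" "mball x r \<subseteq> S"
        unfolding openin_mtopology by blast
      from r(1) obtain n where "(1 / 2) ^ n < r"
        using real_arch_pow_inv[of r "1/2"] by auto
      then have "mball x (1 / 2 ^ n) \<subseteq> mball x r"
        by (intro mball_subset_concentric) (simp add: power_one_over)
      with r(2) have "cylinder {..n} x \<subseteq> S" by (simp add: ball)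
      then show ?thesis
        using open_cylinder[of "{..n}" x] by (intro exI[of _ "cylinder {..n} x"]) (auto simp: cylinder_def)
    qed
    then show "openin euclidean S"
      by (intro open_openin[THEN iffD1] Topological_Spaces.openI)
  next
    fix S :: "(nat \<Rightarrow> 'a) set"
    assume "openin euclidean S"
    then have "open S" by (rule open_openin[THEN iffD2])
    have "\<exists>r>0. mball x r \<subseteq> S" if "x \<in> S" for x
    proof -
      obtain n where "cylinder {..n} x \<subseteq> S"
        using open_contains_cylinder[OF \<open>open S\<close> \<open>x \<in> S\<close>] ..
      then show ?thesis
        by (intro exI[of _ "1 / 2 ^ n"]) (simp add: ball)
    qed
    then show "openin mtopology S"
      unfolding openin_mtopology by simp
  qed
qed

definition cylinders :: "(nat \<Rightarrow> 'a) set set" where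
  "cylinders = insert {} {cylinder U \<omega> | U \<omega>. finite U}"

lemma Int_stable_cylinders: "Int_stable cylinders"
proof (rule Int_stableI)
  fix A B :: "(nat \<Rightarrow> 'a) set"
  assume AB: "A \<in> cylinders" "B \<in> cylinders"
  show "A \<inter> B \<in> cylinders"
  proof (cases "A \<inter> B = {}")
    case False
    then obtain x where x: "x \<in> A" "x \<in> B" by auto
    from AB x obtain U V \<omega> \<omega>' where "finite U" "finite V" "A = cylinder U \<omega>" "B = cylinder V \<omega>'"
      unfolding cylinders_def by blast
    moreover from this x have "A \<inter> B = cylinder (U \<union> V) x"
      by (auto simp: cylinder_def)
    ultimately show ?thesis
      unfolding cylinders_def by blast
  qed (simp add: cylinders_def)
qed

lemma countable_initial_cylinders:
  "countable {cylinder {..n} \<omega> | n (\<omega> :: nat \<Rightarrow> 'a::finite). True}"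
proof (rule countable_subset)
  have *: "cylinder {..n} \<omega> = cylinder {..n} (restrict \<omega> {..n})" for n and \<omega> :: "nat \<Rightarrow> 'a"
    by (auto simp: cylinder_def)
  show "{cylinder {..n} \<omega> | n (\<omega> :: nat \<Rightarrow> 'a). True}
      \<subseteq> (\<Union>n. cylinder {..n} ` (PiE {..n} (\<lambda>_. UNIV)))"
  proof safe
    fix n and \<omega> :: "nat \<Rightarrow> 'a"
    have "cylinder {..n} \<omega> \<in> cylinder {..n} ` (PiE {..n} (\<lambda>_. UNIV))"
      by (subst *) (rule imageI, rule restrict_PiE_iff[THEN iffD2], simp)
    then show "cylinder {..n} \<omega> \<in> (\<Union>n. cylinder {..n} ` (PiE {..n} (\<lambda>_. UNIV)))"
      by blast
  qed
  show "countable (\<Union>n. cylinder {..n} ` (PiE {..n} (\<lambda>_. UNIV :: 'a set)))"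
    by (rule countable_UN, simp, intro countable_finite finite_imageI finite_PiE) auto
qed

lemma sets_borel_cylinders:
  "sets (borel :: (nat \<Rightarrow> 'a::{finite, discrete_topology}) measure) = sigma_sets UNIV cylinders"
proof (rule antisym)
  have "S \<in> sigma_sets UNIV cylinders" if S: "open S" for S :: "(nat \<Rightarrow> 'a) set"
  proof -
    let ?C = "{A \<in> {cylinder {..n} \<omega> | n \<omega>. True}. A \<subseteq> S}"
    have eq: "S = \<Union>?C"
    proof
      show "S \<subseteq> \<Union>?C"
      proof
        fix x assume "x \<in> S"
        then obtain n where "cylinder {..n} x \<subseteq> S"
          using open_contains_cylinder[OF S] by blast
        moreover have "x \<in> cylinder {..n} x" by (simp add: cylinder_def)
        ultimately show "x \<in> \<Union>?C" by blast
      qed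
    qed blast
    have 1: "countable ?C"
      by (rule countable_subset[OF _ countable_initial_cylinders]) blast
    have 2: "?C \<subseteq> sigma_sets UNIV cylinders"
      by (auto intro!: sigma_sets.Basic simp: cylinders_def)
    have "\<Union>?C \<in> sigma_sets UNIV cylinders"
      by (rule sigma_algebra.countable_Union[OF sigma_algebra_sigma_sets 1 2]) simp
    then show ?thesis
      by (subst eq)
  qed
  then show "sets borel \<subseteq> sigma_sets UNIV (cylinders :: (nat \<Rightarrow> 'a) set set)"
    unfolding borel_def by (auto intro!: sigma_sets_mono)
  show "sigma_sets UNIV (cylinders :: (nat \<Rightarrow> 'a) set set) \<subseteq> sets borel"
    by (rule sets.sigma_sets_subset[of _ borel, simplified])
       (auto simp: cylinders_def intro!: borel_open open_cylinder)
qed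

lemma cylinder_in_borel:
  "finite U \<Longrightarrow> cylinder U (\<omega> :: nat \<Rightarrow> 'a::{finite, discrete_topology}) \<in> sets borel"
  by (intro borel_open open_cylinder)

lemma computer_perturbation_unique:
  assumes K: "is_computer_perturbation F \<epsilon> K" and L: "is_computer_perturbation F \<epsilon> L"
  shows "K = L"
proof
  fix x :: "nat \<Rightarrow> 'a"
  have mK: "K x \<in> space (prob_algebra borel)" and mL: "L x \<in> space (prob_algebra borel)"
    using K L by (auto simp: is_computer_perturbation_def dest: measurable_space)
  interpret K: prob_space "K x" using mK by (simp add: space_prob_algebra)
  interpret L: prob_space "L x" using mL by (simp add: space_prob_algebra)
  have s: "sets (K x) = sigma_sets UNIV cylinders" "sets (L x) = sigma_sets UNIV cylinders"
    using mK mL by (auto simp: space_prob_algebra sets_borel_cylinders)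
  have "UNIV = cylinder {} x" by (simp add: cylinder_def)
  then have top: "UNIV \<in> (cylinders :: (nat \<Rightarrow> 'a) set set)"
    unfolding cylinders_def by blast
  show "K x = L x"
  proof (rule measure_eqI_generator_eq[OF Int_stable_cylinders _ _ s, where A = "\<lambda>_. UNIV"])
    show "emeasure (K x) X = emeasure (L x) X" if "X \<in> cylinders" for X
      using that K L unfolding cylinders_def
      by (auto simp: is_computer_perturbation_def K.emeasure_eq_measure L.emeasure_eq_measure)
  qed (use top in auto)
qed

text \<open>The law of one cell: noise with probability \<open>\<epsilon>\<close>, otherwise the letter \<open>a\<close>.\<close>

definition noisy_letter :: "real \<Rightarrow> 'a::finite \<Rightarrow> 'a pmf" where
  "noisy_letter \<epsilon> a = bernoulli_pmf \<epsilon> \<bind> (\<lambda>b. if b then pmf_of_set UNIV else return_pmf a)"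

lemma pmf_noisy_letter:
  fixes a b :: "'a::finite"
  assumes "\<epsilon> \<in> {0..1}"
  shows "pmf (noisy_letter \<epsilon> a) b = (1 - \<epsilon>) * of_bool (b = a) + \<epsilon> / real CARD('a)"
  using assms by (auto simp: noisy_letter_def pmf_bind pmf_return indicator_def)

lemma computer_perturbation_exists:
  assumes F: "F \<in> continuous_maps" and e: "\<epsilon> \<in> {0..1}"
  shows "\<exists>K. is_computer_perturbation F \<epsilon> K"
proof -
  let ?M = "\<lambda>x i. measure_pmf (noisy_letter \<epsilon> (F x i))"
  let ?P = "\<lambda>x. PiM (UNIV :: nat set) (?M x)"
  define K where "K x = distr (?P x) borel (\<lambda>y. y)" for x
  define f where "f x U \<omega> = (\<Prod>i\<in>U. (1 - \<epsilon>) * of_bool (\<omega> i = F x i) + \<epsilon> / real CARD('a))"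
    for x U \<omega>
  have pP: "prob_space (?P x)" for x
    by (intro prob_space_PiM measure_pmf.prob_space_axioms)
  have emb: "prod_emb UNIV (?M x) U (PiE U (\<lambda>i. {\<omega> i})) = cylinder U \<omega>" for x U \<omega>
    by (auto simp: prod_emb_def cylinder_def space_PiM PiE_iff)
  have cylP: "cylinder U \<omega> \<in> sets (?P x)" if "finite U" for x U and \<omega> :: "nat \<Rightarrow> 'a"
    unfolding emb[symmetric, of U \<omega> x] by (rule sets_PiM_I) (use that in auto)
  have cylP': "c \<in> sets (?P x)" if "c \<in> cylinders" for x c
    using that cylP unfolding cylinders_def by auto
  have id: "(\<lambda>y. y) \<in> ?P x \<rightarrow>\<^sub>M borel" for x
  proof (rule measurable_sigma_sets[OF sets_borel_cylinders])
    show "(\<lambda>y. y) -` c \<inter> space (?P x) \<in> sets (?P x)" if "c \<in> cylinders" for c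
      using cylP'[OF that, of x] by (auto simp: space_PiM)
  qed auto
  have em: "emeasure (K x) (cylinder U \<omega>) = ennreal (f x U \<omega>)" if "finite U" for x U \<omega>
  proof -
    have "emeasure (K x) (cylinder U \<omega>) = emeasure (?P x) (cylinder U \<omega>)"
      unfolding K_def using id[of x] cylinder_in_borel[OF that, of \<omega>]
      by (subst emeasure_distr) (auto simp: space_PiM)
    also have "\<dots> = (\<Prod>i\<in>U. emeasure (?M x i) {\<omega> i})"
      unfolding emb[symmetric, of U \<omega> x]
      by (rule emeasure_PiM_emb) (use that in \<open>auto intro: measure_pmf.prob_space_axioms\<close>)
    also have "\<dots> = (\<Prod>i\<in>U. ennreal ((1 - \<epsilon>) * of_bool (\<omega> i = F x i) + \<epsilon> / real CARD('a)))"
      by (simp add: emeasure_pmf_single pmf_noisy_letter[OF e])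
    also have "\<dots> = ennreal (f x U \<omega>)"
      unfolding f_def using e by (intro prod_ennreal) auto
    finally show ?thesis .
  qed
  have f0: "0 \<le> f x U \<omega>" for x U \<omega>
    unfolding f_def using e by (intro prod_nonneg) auto
  have pK: "prob_space (K x)" for x
    unfolding K_def using pP id by (rule prob_space.prob_space_distr)
  have contF: "continuous_on UNIV F" using F by (simp add: continuous_maps_def)
  have fm: "(\<lambda>x. f x U \<omega>) \<in> borel_measurable borel" for U \<omega>
  proof -
    have "{x. \<omega> i = F x i} = F -` cylinder {i} \<omega>" for i
      by (auto simp: cylinder_def)
    then have "open {x. \<omega> i = F x i}" for i
      using open_vimage[OF open_cylinder[of "{i}" \<omega>] contF] by simp
    then have [measurable]: "Measurable.pred borel (\<lambda>x. \<omega> i = F x i)" for i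
      by (simp add: pred_def borel_open)
    show ?thesis
      unfolding f_def by measurable
  qed
  have "K \<in> borel \<rightarrow>\<^sub>M subprob_algebra borel"
  proof (rule measurable_subprob_algebra_generated[OF sets_borel_cylinders Int_stable_cylinders])
    show "(\<lambda>a. emeasure (K a) A) \<in> borel_measurable borel" if "A \<in> cylinders" for A
      using that em fm by (auto simp: cylinders_def)
    have "emeasure (K a) UNIV = 1" for a
      using prob_space.emeasure_space_1[OF pK[of a]] by (simp add: K_def)
    then show "(\<lambda>a. emeasure (K a) UNIV) \<in> borel_measurable borel" by simp
  qed (use pK prob_space_imp_subprob_space in \<open>auto simp: K_def\<close>)
  then have "K \<in> borel \<rightarrow>\<^sub>M prob_algebra borel"
    using pK by (intro measurable_prob_algebraI) auto
  moreover have "measure (K x) (cylinder U \<omega>) = f x U \<omega>" if "finite U" for x U \<omega>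
    using em[OF that] f0 by (simp add: measure_def)
  ultimately show ?thesis
    unfolding is_computer_perturbation_def f_def by blast
qed

lemma ex1_computer_perturbation:
  assumes "F \<in> continuous_maps" "\<epsilon> \<in> {0..1}"
  shows "\<exists>!K. is_computer_perturbation F \<epsilon> K"
  using computer_perturbation_exists[OF assms] computer_perturbation_unique by blast

lemma is_computer_perturbation_computer_perturbation:
  assumes "F \<in> continuous_maps" "\<epsilon> \<in> {0..1}"
  shows "is_computer_perturbation F \<epsilon> (computer_perturbation F \<epsilon>)"
  unfolding computer_perturbation_def by (rule theI'[OF ex1_computer_perturbation[OF assms]])

lemma emeasure_kernel_action:
  fixes \<mu> :: "(nat \<Rightarrow> 'a::{finite, discrete_topology}) measure"
  assumes "\<mu> \<in> space (prob_algebra borel)" "K \<in> borel \<rightarrow>\<^sub>M prob_algebra borel" "A \<in> sets borel"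
  shows "emeasure (\<mu> \<bind> K) A = (\<integral>\<^sup>+x. emeasure (K x) A \<partial>\<mu>)"
proof (rule emeasure_bind)
  have s: "sets \<mu> = sets borel" using assms(1) by (simp add: space_prob_algebra)
  show "space \<mu> \<noteq> {}" using sets_eq_imp_space_eq[OF s] by simp
  show "K \<in> \<mu> \<rightarrow>\<^sub>M subprob_algebra borel"
    using measurable_prob_algebraD[OF assms(2)] s measurable_cong_sets by blast
qed (rule assms(3))

end

theory Submission
  imports Defs
begin

text \<open>
  Write \<open>P f x\<close> for the integral of \<open>f\<close> under \<open>F\<^sub>\<epsilon>(x, \<cdot>)\<close>, for functions \<open>f\<close> of finitely many
  coordinates. If the oscillation of \<open>P\<^sup>t f\<close> tends to 0 for all \<open>f\<close>, the invariant measure is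
  unique; if the orbits \<open>P\<^sup>t f x\<close> and \<open>P\<^sup>t f y\<close> stay apart for some \<open>f\<close>, the Krylov--Bogoliubov
  construction gives two invariant measures.

  The complement of \<open>G\<close> is a union of closed sets \<open>C n \<subseteq> {0..<1}\<close>. For each \<open>n\<close> there is a chain of
  blocks of rapidly growing size; \<open>F\<close> fills the \<open>k\<close>-th block with a single letter \<open>a\<close> or \<open>b\<close>, read off
  the \<open>(k + 1)\<close>-st block, so that information flows in from infinity. A block reads as \<open>a\<close>
  if the frequency of \<open>a\<close> is what a constant block \<open>a\<close> would show under a noise in (a shrinking
  neighbourhood of) \<open>C n\<close>. By Chebyshev's inequality, if \<open>\<epsilon> \<in> C n\<close>, then both letters are
  transmitted with summable error probabilities and two invariant measures survive; otherwise almost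
  every deep block reads as \<open>b\<close>, whatever it was filled with, and the chain forgets its past.

  Prescribing the first \<open>h\<close> coordinates of \<open>F\<close> does no harm for \<open>\<epsilon> > 0\<close>: they are refreshed
  simultaneously with probability at least \<open>\<epsilon>\<^sup>h\<close>, which is a Doeblin condition. For genericity,
  a locally constant uniform version of the mixing condition is open, and so is the condition that
  \<open>F\<close> copies some coordinate, which excludes \<open>\<epsilon> = 0\<close>.
\<close>

section \<open>Local functions\<close>

text \<open>One notion serves observables, letters and events alike; with \<open>S = {}\<close> it
  says that \<open>f\<close> is constant.\<close>

definition depends_on :: "nat set \<Rightarrow> ((nat \<Rightarrow> 'a) \<Rightarrow> 'b) \<Rightarrow> bool" where
  "depends_on S f \<longleftrightarrow> (\<forall>x y. (\<forall>i\<in>S. x i = y i) \<longrightarrow> f x = f y)"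

lemma depends_onI: "(\<And>x y. (\<And>i. i \<in> S \<Longrightarrow> x i = y i) \<Longrightarrow> f x = f y) \<Longrightarrow> depends_on S f"
  unfolding depends_on_def by blast

lemma depends_onD: "depends_on S f \<Longrightarrow> (\<And>i. i \<in> S \<Longrightarrow> x i = y i) \<Longrightarrow> f x = f y"
  unfolding depends_on_def by blast

lemma depends_on_mono: "depends_on S f \<Longrightarrow> S \<subseteq> T \<Longrightarrow> depends_on T f"
  unfolding depends_on_def by blast

lemma depends_on_comp: "depends_on S f \<Longrightarrow> depends_on S (\<lambda>x. h (f x))"
  by (intro depends_onI arg_cong[where f = h]) (rule depends_onD)

lemma depends_on_comp2:
  "depends_on S f \<Longrightarrow> depends_on S g \<Longrightarrow> depends_on S (\<lambda>x. h (f x) (g x))"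
  using depends_onD[of S f] depends_onD[of S g] by (intro depends_onI arg_cong2[where f = h]) blast+

lemma depends_on_const: "depends_on S (\<lambda>x. c)"
  unfolding depends_on_def by simp

lemma depends_on_coord: "i \<in> S \<Longrightarrow> depends_on S (\<lambda>x. x i)"
  unfolding depends_on_def by simp

lemma depends_on_sum:
  assumes "\<And>i. i \<in> I \<Longrightarrow> depends_on S (f i)"
  shows "depends_on S (\<lambda>x. \<Sum>i\<in>I. f i x)"
  by (intro depends_onI sum.cong refl) (rule depends_onD[OF assms], blast+)

lemma depends_on_cylinder: "depends_on S (indicator (cylinder S w) :: (nat \<Rightarrow> 'a) \<Rightarrow> real)"
  by (rule depends_onI) (auto simp: cylinder_def indicator_def)

text \<open>Exactly one of these cylinders contains \<open>y\<close>, that of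
  \<open>w = restrict y S\<close>. Evaluating \<open>f\<close> at an extensional \<open>w\<close> is
  harmless because \<open>f\<close> ignores the coordinates outside \<open>S\<close>.\<close>

lemma local_expansion:
  fixes f :: "(nat \<Rightarrow> 'a::finite) \<Rightarrow> real"
  assumes S: "finite S" and f: "depends_on S f"
  shows "f y = (\<Sum>w\<in>S \<rightarrow>\<^sub>E UNIV. f w * indicator (cylinder S w) y)"
proof -
  have fin: "finite (S \<rightarrow>\<^sub>E (UNIV :: 'a set))"
    using S by (intro finite_PiE) auto
  have r: "restrict y S \<in> S \<rightarrow>\<^sub>E UNIV"
    by simp
  have "(\<Sum>w\<in>S \<rightarrow>\<^sub>E UNIV. f w * indicator (cylinder S w) y) =
      (\<Sum>w\<in>S \<rightarrow>\<^sub>E UNIV. if w = restrict y S then f w else 0)"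
  proof (rule sum.cong)
    fix w :: "nat \<Rightarrow> 'a" assume "w \<in> S \<rightarrow>\<^sub>E UNIV"
    then have "y \<in> cylinder S w \<longleftrightarrow> w = restrict y S"
      by (auto simp: cylinder_def PiE_iff extensional_def fun_eq_iff)
    then show "f w * indicator (cylinder S w) y = (if w = restrict y S then f w else 0)"
      by (simp add: indicator_def)
  qed simp
  also have "\<dots> = f (restrict y S)"
    using fin r by (simp add: sum.delta)
  also have "\<dots> = f y"
    by (rule depends_onD[OF f]) simp
  finally show ?thesis by simp
qed

section \<open>Compactness of the configuration space; continuity as locality\<close>

lemma compact_configurations: "compact (UNIV :: (nat \<Rightarrow> 'a::{finite, discrete_topology}) set)"
proof -
  have "compact_space (product_topology (\<lambda>i::nat. euclidean :: 'a topology) UNIV)"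
    by (simp add: compact_space_product_topology) (simp add: compact_space_def finite_imp_compact)
  then show ?thesis
    unfolding euclidean_product_topology by (simp add: compact_space_def)
qed

text \<open>Around each point, membership in \<open>S\<close> is constant on an initial cylinder. By
  compactness finitely many of these cover the space, and the longest one bounds the coordinates
  that matter.\<close>

lemma clopen_imp_local:
  fixes S :: "(nat \<Rightarrow> 'a::{finite, discrete_topology}) set"
  assumes "open S" "closed S"
  shows "\<exists>m. depends_on {..<m} (\<lambda>x. x \<in> S)"
proof -
  have "\<exists>n. \<forall>y \<in> cylinder {..n} x. y \<in> S \<longleftrightarrow> x \<in> S" for x
  proof (cases "x \<in> S")
    case True
    then show ?thesis using open_contains_cylinder[OF assms(1) True] by blast
  next
    case False
    then have "x \<in> - S" by simp
    with open_contains_cylinder[OF _ this] assms(2) show ?thesis by blast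
  qed
  then obtain n where n: "\<And>x y. y \<in> cylinder {..n x} x \<Longrightarrow> y \<in> S \<longleftrightarrow> x \<in> S"
    by metis
  obtain C where C: "finite C" "UNIV \<subseteq> (\<Union>x\<in>C. cylinder {..n x} x)"
  proof (rule compactE_image[OF compact_configurations, of UNIV "\<lambda>x. cylinder {..n x} x"])
    show "open (cylinder {..n x} x)" for x :: "nat \<Rightarrow> 'a" by (intro open_cylinder) simp
    show "UNIV \<subseteq> (\<Union>x. cylinder {..n x} x)" by (auto simp: cylinder_def)
  qed blast
  have "depends_on {..<Suc (Max (n ` C))} (\<lambda>x. x \<in> S)"
  proof (rule depends_onI)
    fix x y :: "nat \<Rightarrow> 'a"
    assume xy: "\<And>i. i \<in> {..<Suc (Max (n ` C))} \<Longrightarrow> x i = y i"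
    from C(2) obtain z where z: "z \<in> C" "x \<in> cylinder {..n z} z" by blast
    have "n z \<le> Max (n ` C)" using C(1) z(1) by simp
    then have "y \<in> cylinder {..n z} z"
      using z(2) xy by (auto simp: cylinder_def less_Suc_eq_le)
    then show "(x \<in> S) = (y \<in> S)" using n z(2) by blast
  qed
  then show ?thesis ..
qed

lemma local_imp_open:
  fixes f :: "(nat \<Rightarrow> 'a::{finite, discrete_topology}) \<Rightarrow> 'b"
  assumes S: "finite S" and f: "depends_on S f"
  shows "open {x. f x \<in> X}"
proof (rule Topological_Spaces.openI)
  fix x assume "x \<in> {x. f x \<in> X}"
  then have "f x \<in> X" by simp
  have "cylinder S x \<subseteq> {x. f x \<in> X}"
  proof
    fix y assume "y \<in> cylinder S x"
    then have "f y = f x" by (intro depends_onD[OF f]) (simp add: cylinder_def)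
    with \<open>f x \<in> X\<close> show "y \<in> {x. f x \<in> X}" by simp
  qed
  then show "\<exists>T. open T \<and> x \<in> T \<and> T \<subseteq> {x. f x \<in> X}"
    using open_cylinder[OF S, of x] by (intro exI[of _ "cylinder S x"]) (simp add: cylinder_def)
qed

text \<open>The event \<open>F x i = a\<close> is the preimage of a clopen set, hence local. There
  are finitely many pairs of \<open>i \<in> S\<close> and \<open>a\<close>, so one bound serves them
  all.\<close>

lemma continuous_map_local:
  fixes F :: "(nat \<Rightarrow> 'a::{finite, discrete_topology}) \<Rightarrow> nat \<Rightarrow> 'a"
  assumes "F \<in> continuous_maps" "finite S"
  shows "\<exists>m. \<forall>i\<in>S. depends_on {..<m} (\<lambda>x. F x i)"
proof -
  have F: "continuous_on UNIV F" using assms(1) by (simp add: continuous_maps_def)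
  have "\<exists>m. depends_on {..<m} (\<lambda>x. F x i = a)" for i a
  proof -
    have *: "{x. F x i \<in> X} = F -` {y. y i \<in> X}" for X
      by auto
    have o: "open {x. F x i \<in> X}" for X
      unfolding * by (rule open_vimage[OF local_imp_open[of "{i}"] F]) (auto intro: depends_on_coord)
    have "closed {x. F x i = a}"
      using o[of "- {a}"] by (simp add: closed_def Collect_neg_eq)
    moreover have "open {x. F x i = a}" using o[of "{a}"] by simp
    ultimately show ?thesis
      using clopen_imp_local[of "{x. F x i = a}"] by simp
  qed
  then obtain m where m: "\<And>i a. depends_on {..<m i a} (\<lambda>x. F x i = a)" by metis
  define M where "M = Max ((\<lambda>(i, a). m i a) ` (S \<times> UNIV))"
  have "depends_on {..<M} (\<lambda>x. F x i)" if "i \<in> S" for i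
  proof (rule depends_onI)
    fix x y :: "nat \<Rightarrow> 'a" assume xy: "\<And>j. j \<in> {..<M} \<Longrightarrow> x j = y j"
    have "m i (F x i) \<le> M"
      unfolding M_def using that assms(2) by (intro Max_ge) (auto intro!: rev_image_eqI[of "(i, F x i)"])
    then show "F x i = F y i"
      using depends_onD[OF m[of i "F x i"], of x y] xy by auto
  qed
  then show ?thesis by blast
qed

lemma continuous_mapsI:
  fixes F :: "(nat \<Rightarrow> 'a::{finite, discrete_topology}) \<Rightarrow> nat \<Rightarrow> 'a"
  assumes "\<And>i. \<exists>S. finite S \<and> depends_on S (\<lambda>x. F x i)"
  shows "F \<in> continuous_maps"
proof -
  have "continuous_on UNIV (\<lambda>x. F x i)" for i
  proof -
    obtain S where "finite S" "depends_on S (\<lambda>x. F x i)" using assms by blast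
    from local_imp_open[OF this] show ?thesis
      by (subst continuous_on_open_vimage) (auto simp: vimage_def)
  qed
  then show ?thesis
    unfolding continuous_maps_def by (simp add: continuous_on_coordinatewise_then_product)
qed

section \<open>The transfer operator\<close>

text \<open>The Markov operator of the kernel, dual to its action on measures.\<close>

definition transfer :: "((nat \<Rightarrow> 'a::{finite, discrete_topology}) \<Rightarrow> (nat \<Rightarrow> 'a)) \<Rightarrow> real \<Rightarrow>
    ((nat \<Rightarrow> 'a) \<Rightarrow> real) \<Rightarrow> (nat \<Rightarrow> 'a) \<Rightarrow> real" where
  "transfer F \<epsilon> f x = (\<integral>y. f y \<partial>computer_perturbation F \<epsilon> x)"

text \<open>The probability that a cell whose noiseless value is \<open>a\<close> shows the letter
  \<open>b\<close>.\<close>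

definition noise :: "real \<Rightarrow> 'a::finite \<Rightarrow> 'a \<Rightarrow> real" where
  "noise \<epsilon> a b = (1 - \<epsilon>) * of_bool (b = a) + \<epsilon> / real CARD('a)"

lemma noise_nonneg: "\<epsilon> \<in> {0..1} \<Longrightarrow> 0 \<le> noise \<epsilon> a b"
  by (simp add: noise_def)

lemma noise_le_1:
  fixes a b :: "'a::finite"
  assumes "\<epsilon> \<in> {0..1}"
  shows "noise \<epsilon> a b \<le> 1"
proof -
  have "1 \<le> real CARD('a)"
    by (simp add: Suc_leI)
  then have "\<epsilon> / real CARD('a) \<le> \<epsilon> / 1"
    using assms by (intro divide_left_mono) auto
  moreover have "(1 - \<epsilon>) * of_bool (b = a) \<le> 1 - \<epsilon>"
    using assms by simp
  ultimately show ?thesis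
    by (simp add: noise_def)
qed

locale prob_config = prob_space \<mu> for \<mu> :: "(nat \<Rightarrow> 'a::{finite, discrete_topology}) measure" +
  assumes sets_eq: "sets \<mu> = sets borel"
begin

lemma space_eq: "space \<mu> = UNIV"
  using sets_eq_imp_space_eq[OF sets_eq] by simp

lemma prob_UNIV: "measure \<mu> UNIV = 1"
  using prob_space by (simp only: space_eq)

lemma integrable_cylinder:
  "finite S \<Longrightarrow> integrable \<mu> (indicator (cylinder S w) :: _ \<Rightarrow> real)"
  using cylinder_in_borel[of S w] by (intro integrable_real_indicator) (simp_all add: sets_eq emeasure_eq_measure)

lemma integrable_local:
  fixes f :: "(nat \<Rightarrow> 'a) \<Rightarrow> real"
  assumes S: "finite S" "depends_on S f"
  shows "integrable \<mu> f"
proof -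
  have "integrable \<mu> (\<lambda>y. \<Sum>w\<in>S \<rightarrow>\<^sub>E UNIV. f w * indicator (cylinder S w) y)"
    by (intro Bochner_Integration.integrable_sum Bochner_Integration.integrable_mult_right integrable_cylinder S(1))
  then show ?thesis
    unfolding local_expansion[OF S, symmetric] .
qed

lemma integral_local:
  fixes f :: "(nat \<Rightarrow> 'a) \<Rightarrow> real"
  assumes S: "finite S" "depends_on S f"
  shows "(\<integral>y. f y \<partial>\<mu>) = (\<Sum>w\<in>S \<rightarrow>\<^sub>E UNIV. f w * measure \<mu> (cylinder S w))"
proof -
  have "(\<integral>y. f y \<partial>\<mu>) = (\<integral>y. (\<Sum>w\<in>S \<rightarrow>\<^sub>E UNIV. f w * indicator (cylinder S w) y) \<partial>\<mu>)"
    unfolding local_expansion[OF S, symmetric] ..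
  also have "\<dots> = (\<Sum>w\<in>S \<rightarrow>\<^sub>E UNIV. f w * measure \<mu> (cylinder S w))"
    by (subst Bochner_Integration.integral_sum)
       (simp_all add: space_eq integrable_cylinder S(1))
  finally show ?thesis .
qed

end

lemma prob_config_iff: "prob_config \<mu> \<longleftrightarrow> \<mu> \<in> space (prob_algebra borel)"
  by (auto simp: prob_config_def prob_config_axioms_def space_prob_algebra)

lemma prob_config_eqI:
  assumes "prob_config \<mu>" "prob_config \<nu>"
    and eq: "\<And>U \<omega>. finite U \<Longrightarrow> measure \<mu> (cylinder U \<omega>) = measure \<nu> (cylinder U \<omega>)"
  shows "\<mu> = \<nu>"
proof -
  interpret \<mu>: prob_config \<mu> by fact
  interpret \<nu>: prob_config \<nu> by fact
  have "UNIV = cylinder {} undefined" by (simp add: cylinder_def)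
  then have top: "UNIV \<in> (cylinders :: (nat \<Rightarrow> 'a) set set)"
    unfolding cylinders_def by blast
  show ?thesis
  proof (rule measure_eqI_generator_eq[OF Int_stable_cylinders, where A = "\<lambda>_. UNIV" and \<Omega> = UNIV])
    show "emeasure \<mu> X = emeasure \<nu> X" if "X \<in> cylinders" for X
      using that eq unfolding cylinders_def
      by (auto simp: \<mu>.emeasure_eq_measure \<nu>.emeasure_eq_measure)
  qed (use top in \<open>auto simp: \<mu>.sets_eq \<nu>.sets_eq sets_borel_cylinders\<close>)
qed

locale perturbed_map =
  fixes F :: "(nat \<Rightarrow> 'a::{finite, discrete_topology}) \<Rightarrow> nat \<Rightarrow> 'a" and \<epsilon> :: real
  assumes F: "F \<in> continuous_maps" and eps: "\<epsilon> \<in> {0..1}"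
begin

abbreviation "K \<equiv> computer_perturbation F \<epsilon>"
abbreviation "P \<equiv> transfer F \<epsilon>"

lemma K_measurable: "K \<in> borel \<rightarrow>\<^sub>M prob_algebra borel"
  using is_computer_perturbation_computer_perturbation[OF F eps]
  by (simp add: is_computer_perturbation_def)

lemma measure_cylinder:
  "finite U \<Longrightarrow> measure (K x) (cylinder U \<omega>) = (\<Prod>i\<in>U. noise \<epsilon> (F x i) (\<omega> i))"
  using is_computer_perturbation_computer_perturbation[OF F eps]
  by (simp add: is_computer_perturbation_def noise_def)

sublocale K: prob_config "K x" for x
  unfolding prob_config_iff using measurable_space[OF K_measurable] by simp

text \<open>The kernel is a product measure. The formula shows that \<open>P f x\<close> sees
  \<open>x\<close> only through the outputs \<open>F x i\<close> with
  \<open>i \<in> S\<close>.\<close>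

lemma P_expansion:
  assumes "finite S" "depends_on S f"
  shows "P f x = (\<Sum>w\<in>S \<rightarrow>\<^sub>E UNIV. f w * (\<Prod>i\<in>S. noise \<epsilon> (F x i) (w i)))"
  unfolding transfer_def K.integral_local[OF assms] by (simp add: measure_cylinder assms(1))

lemma P_cong:
  assumes "finite S" "depends_on S f" "\<And>i. i \<in> S \<Longrightarrow> F x i = F y i"
  shows "P f x = P f y"
  unfolding P_expansion[OF assms(1,2)] using assms(3) by (intro sum.cong arg_cong2[where f = "(*)"] prod.cong) auto

lemma P_depends:
  assumes "finite S" "depends_on S f" "\<And>i. i \<in> S \<Longrightarrow> depends_on T (\<lambda>x. F x i)"
  shows "depends_on T (P f)"
proof (rule depends_onI)
  fix x y :: "nat \<Rightarrow> 'a" assume "\<And>i. i \<in> T \<Longrightarrow> x i = y i"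
  then have "F x i = F y i" if "i \<in> S" for i
    using depends_onD[OF assms(3)[OF that], of x y] by blast
  then show "P f x = P f y"
    unfolding P_expansion[OF assms(1,2)] by (intro sum.cong) auto
qed

lemma P_indicator: "P (indicator A) = (\<lambda>x. measure (K x) A)"
  unfolding transfer_def by (simp add: K.space_eq)

text \<open>Finitely many outputs of a continuous map read finitely many inputs. Hence the iterates
  of \<open>P\<close> never leave the local functions, where integrability is automatic.\<close>

lemma P_local:
  assumes "finite S" "depends_on S f"
  shows "\<exists>m. depends_on {..<m} (P f)"
  using continuous_map_local[OF F assms(1)] P_depends[OF assms] by blast

lemma P_const: "P (\<lambda>x. c) = (\<lambda>x. c)"
  unfolding transfer_def by (auto simp: K.prob_space)

lemma P_add:
  assumes "finite S" "depends_on S f" "finite T" "depends_on T g"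
  shows "P (\<lambda>x. f x + g x) = (\<lambda>x. P f x + P g x)"
  unfolding transfer_def using K.integrable_local[OF assms(1,2)] K.integrable_local[OF assms(3,4)] by auto

lemma P_diff:
  assumes "finite S" "depends_on S f" "finite T" "depends_on T g"
  shows "P (\<lambda>x. f x - g x) = (\<lambda>x. P f x - P g x)"
  unfolding transfer_def using K.integrable_local[OF assms(1,2)] K.integrable_local[OF assms(3,4)] by auto

lemma P_cmult: "P (\<lambda>x. c * f x) = (\<lambda>x. c * P f x)"
  unfolding transfer_def by auto

lemma P_sum:
  assumes "\<And>i. i \<in> I \<Longrightarrow> finite (S i)" "\<And>i. i \<in> I \<Longrightarrow> depends_on (S i) (f i)"
  shows "P (\<lambda>x. \<Sum>i\<in>I. f i x) = (\<lambda>x. \<Sum>i\<in>I. P (f i) x)"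
  unfolding transfer_def
  by (intro ext Bochner_Integration.integral_sum K.integrable_local[OF assms])

lemma P_mono:
  assumes "finite S" "depends_on S f" "finite T" "depends_on T g" "\<And>x. f x \<le> g x"
  shows "P f x \<le> P g x"
  unfolding transfer_def
  by (intro integral_mono K.integrable_local[OF assms(1,2)] K.integrable_local[OF assms(3,4)] assms(5))

lemma P_ge: "finite S \<Longrightarrow> depends_on S f \<Longrightarrow> (\<And>x. c \<le> f x) \<Longrightarrow> c \<le> P f x"
  using P_mono[of "{}" "\<lambda>x. c" S f x] by (simp add: P_const depends_on_const)

lemma P_le: "finite S \<Longrightarrow> depends_on S f \<Longrightarrow> (\<And>x. f x \<le> c) \<Longrightarrow> P f x \<le> c"
  using P_mono[of S f "{}" "\<lambda>x. c" x] by (simp add: P_const depends_on_const)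

lemma Pn_local:
  assumes "finite S" "depends_on S f"
  shows "\<exists>T. finite T \<and> depends_on T ((P ^^ t) f)"
proof (induction t)
  case 0
  then show ?case using assms by auto
next
  case (Suc t)
  then obtain T where "finite T" "depends_on T ((P ^^ t) f)" by blast
  from P_local[OF this] obtain m where "depends_on {..<m} ((P ^^ Suc t) f)" by auto
  then show ?case by (intro exI[of _ "{..<m}"]) simp
qed

lemma Pn_add:
  assumes "finite S" "depends_on S f" "finite T" "depends_on T g"
  shows "(P ^^ t) (\<lambda>x. f x + g x) = (\<lambda>x. (P ^^ t) f x + (P ^^ t) g x)"
proof (induction t)
  case (Suc t)
  obtain S' where "finite S'" "depends_on S' ((P ^^ t) f)" using Pn_local[OF assms(1,2)] by blast
  moreover obtain T' where "finite T'" "depends_on T' ((P ^^ t) g)" using Pn_local[OF assms(3,4)] by blast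
  ultimately show ?case using Suc P_add by simp
qed simp

lemma Pn_cmult: "(P ^^ t) (\<lambda>x. c * f x) = (\<lambda>x. c * (P ^^ t) f x)"
  by (induction t) (simp_all add: P_cmult)

lemma Pn_const: "(P ^^ t) (\<lambda>x. c) = (\<lambda>x. c)"
  by (induction t) (simp_all add: P_const)

lemma Pn_mono:
  assumes "finite S" "depends_on S f" "finite T" "depends_on T g" "\<And>x. f x \<le> g x"
  shows "(P ^^ t) f x \<le> (P ^^ t) g x"
proof (induction t arbitrary: x)
  case (Suc t)
  obtain S' where "finite S'" "depends_on S' ((P ^^ t) f)" using Pn_local[OF assms(1,2)] by blast
  moreover obtain T' where "finite T'" "depends_on T' ((P ^^ t) g)" using Pn_local[OF assms(3,4)] by blast
  ultimately show ?case using Suc P_mono by simp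
qed (simp add: assms)

lemma Pn_ge: "finite S \<Longrightarrow> depends_on S f \<Longrightarrow> (\<And>x. c \<le> f x) \<Longrightarrow> c \<le> (P ^^ t) f x"
  using Pn_mono[of "{}" "\<lambda>x. c" S f t x] by (simp add: Pn_const depends_on_const)

lemma Pn_le: "finite S \<Longrightarrow> depends_on S f \<Longrightarrow> (\<And>x. f x \<le> c) \<Longrightarrow> (P ^^ t) f x \<le> c"
  using Pn_mono[of S f "{}" "\<lambda>x. c" t x] by (simp add: Pn_const depends_on_const)

text \<open>\<open>P\<close> is monotone and fixes constants, so averaging cannot increase the
  oscillation.\<close>

lemma P_oscillation:
  assumes "finite S" "depends_on S f" "\<And>x y. f x - f y \<le> \<eta>"
  shows "P f x - P f y \<le> \<eta>"
proof -
  have "f z - \<eta> \<le> P f y" for z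
    by (rule P_ge[OF assms(1,2)]) (use assms(3)[of z] in \<open>simp add: algebra_simps\<close>)
  then have "P f x \<le> P f y + \<eta>"
    by (intro P_le[OF assms(1,2)]) (simp add: algebra_simps)
  then show ?thesis by simp
qed

lemma Pn_oscillation_antimono:
  assumes "finite S" "depends_on S f" "\<And>x y. (P ^^ s) f x - (P ^^ s) f y \<le> \<eta>" "s \<le> t"
  shows "(P ^^ t) f x - (P ^^ t) f y \<le> \<eta>"
  using assms(4)
proof (induction t arbitrary: x y rule: dec_induct)
  case base
  then show ?case by (rule assms(3))
next
  case (step t)
  obtain T where "finite T" "depends_on T ((P ^^ t) f)" using Pn_local[OF assms(1,2)] by blast
  from P_oscillation[OF this step.IH] show ?case by simp
qed

lemma measure_action:
  assumes "\<mu> \<in> space (prob_algebra borel)" "A \<in> sets borel"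
  shows "measure (\<mu> \<bind> K) A = (\<integral>x. measure (K x) A \<partial>\<mu>)"
proof -
  interpret \<mu>: prob_config \<mu> using assms(1) by (simp add: prob_config_iff)
  have "K \<in> \<mu> \<rightarrow>\<^sub>M subprob_algebra borel"
    using measurable_prob_algebraD[OF K_measurable] measurable_cong_sets[OF \<mu>.sets_eq refl] by blast
  from \<mu>.measure_bind[OF this assms(2)] show ?thesis .
qed

text \<open>Invariance gives the identity on cylinders, and the finite expansion carries it to all
  local functions.\<close>

lemma integral_invariant:
  assumes inv: "invariant_measure K \<mu>" and S: "finite S" "depends_on S f"
  shows "(\<integral>x. P f x \<partial>\<mu>) = (\<integral>x. f x \<partial>\<mu>)"
proof -
  have \<mu>: "\<mu> \<in> space (prob_algebra borel)" and eq: "\<mu> \<bind> K = \<mu>"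
    using inv by (auto simp: invariant_measure_def)
  interpret \<mu>: prob_config \<mu> using \<mu> by (simp add: prob_config_iff)
  have dep: "depends_on S (indicator (cylinder S w) :: (nat \<Rightarrow> 'a) \<Rightarrow> real)" for w
    by (rule depends_on_cylinder)
  have cyl: "(\<integral>x. measure (K x) (cylinder S w) \<partial>\<mu>) = measure \<mu> (cylinder S w)" for w
    using measure_action[OF \<mu> cylinder_in_borel[OF S(1)], of w] eq by simp
  have "(\<integral>x. P f x \<partial>\<mu>) = (\<integral>x. (\<Sum>w\<in>S \<rightarrow>\<^sub>E UNIV. f w * measure (K x) (cylinder S w)) \<partial>\<mu>)"
    unfolding transfer_def K.integral_local[OF S] ..
  also have "\<dots> = (\<Sum>w\<in>S \<rightarrow>\<^sub>E UNIV. f w * (\<integral>x. measure (K x) (cylinder S w) \<partial>\<mu>))"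
  proof (subst Bochner_Integration.integral_sum)
    fix w
    obtain T where T: "finite T" "depends_on T (P (indicator (cylinder S w)))"
      using P_local[OF S(1) dep] by blast
    show "integrable \<mu> (\<lambda>x. f w * measure (K x) (cylinder S w))"
      using \<mu>.integrable_local[OF T] by (simp add: P_indicator)
  qed simp
  also have "\<dots> = (\<integral>x. f x \<partial>\<mu>)"
    unfolding cyl \<mu>.integral_local[OF S] ..
  finally show ?thesis .
qed

lemma integral_invariant_Pn:
  assumes "invariant_measure K \<mu>" "finite S" "depends_on S f"
  shows "(\<integral>x. (P ^^ t) f x \<partial>\<mu>) = (\<integral>x. f x \<partial>\<mu>)"
proof (induction t)
  case (Suc t)
  obtain T where "finite T" "depends_on T ((P ^^ t) f)" using Pn_local[OF assms(2,3)] by blast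
  from integral_invariant[OF assms(1) this] Suc show ?case by simp
qed simp

end

section \<open>Existence and uniqueness of invariant measures\<close>

text \<open>Over a finite discrete alphabet these are the clopen sets. Unlike the cylinders they
  form an algebra, as the Caratheodory extension requires.\<close>

definition local_sets :: "(nat \<Rightarrow> 'a) set set" where
  "local_sets = {C. \<exists>S. finite S \<and> depends_on S (\<lambda>x. x \<in> C)}"

lemma algebra_local_sets: "algebra UNIV (local_sets :: (nat \<Rightarrow> 'a) set set)"
  unfolding algebra_iff_Un
proof (intro conjI ballI)
  show "{} \<in> (local_sets :: (nat \<Rightarrow> 'a) set set)"
    by (auto simp: local_sets_def intro: depends_on_const)
  show "UNIV - C \<in> local_sets" if "C \<in> local_sets" for C :: "(nat \<Rightarrow> 'a) set"
    using that by (auto simp: local_sets_def intro: depends_on_comp[where h = Not])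
  show "C \<union> D \<in> local_sets" if C: "C \<in> local_sets" and D: "D \<in> local_sets" for C D :: "(nat \<Rightarrow> 'a) set"
  proof -
    from C D obtain S T where "finite S" "depends_on S (\<lambda>x. x \<in> C)" "finite T" "depends_on T (\<lambda>x. x \<in> D)"
      by (auto simp: local_sets_def)
    then have "finite (S \<union> T)" "depends_on (S \<union> T) (\<lambda>x. x \<in> C \<or> x \<in> D)"
      by (auto intro!: depends_on_comp2[where h = "(\<or>)"] elim: depends_on_mono)
    then show ?thesis by (auto simp: local_sets_def)
  qed
qed auto

lemma cylinder_in_local_sets: "finite S \<Longrightarrow> cylinder S w \<in> local_sets"
  unfolding local_sets_def by (auto simp: cylinder_def depends_on_def)

lemma local_sets_open:
  fixes C :: "(nat \<Rightarrow> 'a::{finite, discrete_topology}) set"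
  assumes "C \<in> local_sets"
  shows "open C"
proof -
  obtain S where "finite S" "depends_on S (\<lambda>x. x \<in> C)"
    using assms by (auto simp: local_sets_def)
  from local_imp_open[OF this, of "{True}"] show ?thesis by simp
qed

lemma sets_borel_local_sets:
  "sets (borel :: (nat \<Rightarrow> 'a::{finite, discrete_topology}) measure) = sigma_sets UNIV local_sets"
proof (rule antisym)
  have "(cylinders :: (nat \<Rightarrow> 'a) set set) \<subseteq> local_sets"
    by (auto simp: cylinders_def cylinder_in_local_sets) (simp add: local_sets_def depends_on_const exI[of _ "{}"])
  then show "sets (borel :: (nat \<Rightarrow> 'a) measure) \<subseteq> sigma_sets UNIV local_sets"
    unfolding sets_borel_cylinders by (intro sigma_sets_mono')
  show "sigma_sets UNIV local_sets \<subseteq> sets (borel :: (nat \<Rightarrow> 'a) measure)"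
    by (rule sets.sigma_sets_subset[of _ borel, simplified]) (use local_sets_open borel_open in blast)+
qed

text \<open>The complements form an open cover with a finite subcover. This makes continuity at the
  empty set automatic for additive set functions on \<open>local_sets\<close>.\<close>

lemma decreasing_local_sets:
  fixes A :: "nat \<Rightarrow> (nat \<Rightarrow> 'a::{finite, discrete_topology}) set"
  assumes "range A \<subseteq> local_sets" "decseq A" "(\<Inter>i. A i) = {}"
  shows "\<exists>N. \<forall>i\<ge>N. A i = {}"
proof -
  have "open (- A i)" for i
  proof -
    have "UNIV - A i \<in> local_sets"
      using assms(1) by (intro algebra.compl_sets[OF algebra_local_sets]) auto
    then show ?thesis by (simp add: local_sets_open Compl_eq_Diff_UNIV)
  qed
  moreover have "UNIV \<subseteq> (\<Union>i. - A i)" using assms(3) by blast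
  ultimately obtain I where I: "finite I" "UNIV \<subseteq> (\<Union>i\<in>I. - A i)"
    using compactE_image[OF compact_configurations, of UNIV "\<lambda>i. - A i"] by metis
  have "A i = {}" if "i \<ge> Max I" for i
  proof -
    have "A i \<subseteq> A j" if "j \<in> I" for j
      using decseqD[OF assms(2), of j i] Max_ge[OF I(1) that] \<open>i \<ge> Max I\<close> by auto
    then show ?thesis using I(2) by blast
  qed
  then show ?thesis by blast
qed

text \<open>Compactness replaces the Kolmogorov extension theorem.\<close>

lemma local_charge_extends:
  fixes l :: "(nat \<Rightarrow> 'a::{finite, discrete_topology}) set \<Rightarrow> real"
  assumes nonneg: "\<And>C. C \<in> local_sets \<Longrightarrow> 0 \<le> l C"
    and add: "\<And>C D. C \<in> local_sets \<Longrightarrow> D \<in> local_sets \<Longrightarrow> C \<inter> D = {} \<Longrightarrow> l (C \<union> D) = l C + l D"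
    and top: "l UNIV = 1"
  shows "\<exists>\<mu>. prob_config \<mu> \<and> (\<forall>C\<in>local_sets. measure \<mu> C = l C)"
proof -
  interpret algebra UNIV "local_sets :: (nat \<Rightarrow> 'a) set set" by (rule algebra_local_sets)
  have l0: "l {} = 0" using add[of "{}" "{}"] by simp
  have "\<exists>m :: (nat \<Rightarrow> 'a) set \<Rightarrow> ennreal. (\<forall>s\<in>local_sets. m s = ennreal (l s)) \<and>
      measure_space UNIV (sigma_sets UNIV local_sets) m"
  proof (rule caratheodory_empty_continuous)
    show "positive local_sets (\<lambda>s. ennreal (l s))" by (simp add: positive_def l0)
    show "additive local_sets (\<lambda>s. ennreal (l s))"
      by (simp add: additive_def add nonneg ennreal_plus)
    fix A :: "nat \<Rightarrow> (nat \<Rightarrow> 'a) set"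
    assume "range A \<subseteq> local_sets" "decseq A" "(\<Inter>i. A i) = {}"
    from decreasing_local_sets[OF this] obtain N where "\<And>i. i \<ge> N \<Longrightarrow> A i = {}" by blast
    then show "(\<lambda>i. ennreal (l (A i))) \<longlonglongrightarrow> 0"
      by (intro tendsto_eventually eventually_sequentiallyI[of N]) (simp add: l0)
  qed simp
  then obtain m where m: "\<And>s. s \<in> local_sets \<Longrightarrow> m s = ennreal (l s)"
    "measure_space UNIV (sigma_sets UNIV local_sets) m" by blast
  define \<mu> where "\<mu> = measure_of UNIV local_sets m"
  have sets: "sets \<mu> = sets borel"
    by (simp add: \<mu>_def sets_borel_local_sets)
  have em: "emeasure \<mu> C = ennreal (l C)" if "C \<in> local_sets" for C
  proof -
    have "emeasure \<mu> C = m C"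
      by (rule emeasure_measure_of[OF \<mu>_def]) (use that m(2) in \<open>auto simp: \<mu>_def measure_space_def\<close>)
    with m(1)[OF that] show ?thesis by simp
  qed
  have "prob_space \<mu>"
    using em[of UNIV] assms(3) by (intro prob_spaceI) (simp add: \<mu>_def)
  then have "prob_config \<mu>"
    using sets by (simp add: prob_config_def prob_config_axioms_def)
  moreover have "measure \<mu> C = l C" if "C \<in> local_sets" for C
    using em[OF that] nonneg[OF that] by (simp add: measure_def)
  ultimately show ?thesis by blast
qed

section \<open>Krylov--Bogoliubov averages\<close>

context perturbed_map
begin

text \<open>Cylinders determine a Borel probability measure, so testing invariance on their
  indicators is enough.\<close>

lemma invariant_measureI:
  assumes \<mu>: "prob_config \<mu>"
    and eq: "\<And>S w. finite S \<Longrightarrow> (\<integral>x. P (indicator (cylinder S w)) x \<partial>\<mu>) = measure \<mu> (cylinder S w)"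
  shows "invariant_measure K \<mu>"
proof -
  interpret \<mu>: prob_config \<mu> by fact
  have \<mu>': "\<mu> \<in> space (prob_algebra borel)" using \<mu> by (simp add: prob_config_iff)
  have "\<mu> \<bind> K \<in> space (prob_algebra borel)"
    using measurable_space[OF measurable_bind_prob_space[of "\<lambda>_::unit. \<mu>" "count_space UNIV" borel K borel]]
      \<mu>' K_measurable by simp
  then have \<nu>: "prob_config (\<mu> \<bind> K)" by (simp add: prob_config_iff)
  have "\<mu> \<bind> K = \<mu>"
  proof (rule prob_config_eqI[OF \<nu> \<mu>])
    fix S w assume S: "finite (S :: nat set)"
    show "measure (\<mu> \<bind> K) (cylinder S w) = measure \<mu> (cylinder S w)"
      unfolding measure_action[OF \<mu>' cylinder_in_borel[OF S]] using eq[OF S, of w] by (simp add: P_indicator)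
  qed
  then show ?thesis using \<mu>' by (simp add: invariant_measure_def)
qed

definition orbit_average :: "(nat \<Rightarrow> 'a) \<Rightarrow> nat \<Rightarrow> ((nat \<Rightarrow> 'a) \<Rightarrow> real) \<Rightarrow> real" where
  "orbit_average x n f = (\<Sum>t\<le>n. (P ^^ t) f x) / real (Suc n)"

lemma orbit_average_bounds:
  assumes "\<And>t. (P ^^ t) f x \<in> {c..d}"
  shows "orbit_average x n f \<in> {c..d}"
proof -
  have "(\<Sum>t\<le>n. c) \<le> (\<Sum>t\<le>n. (P ^^ t) f x)" "(\<Sum>t\<le>n. (P ^^ t) f x) \<le> (\<Sum>t\<le>n. d)"
    using assms by (intro sum_mono; simp)+
  then show ?thesis
    by (simp add: orbit_average_def field_simps del: sum.atMost_Suc)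
qed

lemma orbit_average_add:
  assumes "finite S" "depends_on S f" "finite T" "depends_on T g"
  shows "orbit_average x n (\<lambda>x. f x + g x) = orbit_average x n f + orbit_average x n g"
  unfolding orbit_average_def Pn_add[OF assms] by (simp add: sum.distrib add_divide_distrib)

lemma orbit_average_cmult: "orbit_average x n (\<lambda>x. c * f x) = c * orbit_average x n f"
  unfolding orbit_average_def Pn_cmult by (simp add: sum_distrib_left)

lemma orbit_average_const: "orbit_average x n (\<lambda>x. c) = c"
  unfolding orbit_average_def Pn_const by simp

lemma orbit_average_sum:
  assumes "finite I" "finite S" "\<And>i. i \<in> I \<Longrightarrow> depends_on S (f i)"
  shows "orbit_average x n (\<lambda>x. \<Sum>i\<in>I. f i x) = (\<Sum>i\<in>I. orbit_average x n (f i))"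
  using assms(1,3)
proof (induction I)
  case (insert i I)
  have "depends_on S (\<lambda>x. \<Sum>i\<in>I. f i x)"
    using insert.prems by (intro depends_on_sum) auto
  then show ?case
    using insert by (simp add: orbit_average_add[OF assms(2) _ assms(2)])
qed (simp add: orbit_average_const)

text \<open>The two sums differ by a shift of one time step and telescope to boundary terms, which
  makes the averages asymptotically invariant.\<close>

lemma orbit_average_P:
  "orbit_average x n (P f) = orbit_average x n f + ((P ^^ Suc n) f x - f x) / real (Suc n)"
proof -
  have "(\<Sum>t\<le>n. (P ^^ t) (P f) x) = (\<Sum>t\<le>n. (P ^^ Suc t) f x)"
    by (simp add: funpow_swap1)
  also have "\<dots> = (\<Sum>t\<le>Suc n. (P ^^ t) f x) - f x"
    by (simp add: sum.atMost_Suc_shift del: sum.atMost_Suc)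
  also have "\<dots> = (\<Sum>t\<le>n. (P ^^ t) f x) + ((P ^^ Suc n) f x - f x)"
    by simp
  finally show ?thesis
    unfolding orbit_average_def by (simp add: add_divide_distrib)
qed

text \<open>Krylov--Bogoliubov: the measure is a cluster point of the averages along the orbit of \<open>x\<close>.\<close>

lemma ex_invariant_measure:
  "\<exists>\<mu>. invariant_measure K \<mu> \<and>
    (\<forall>S f c d. finite S \<longrightarrow> depends_on S f \<longrightarrow> (\<forall>t. (P ^^ t) f x \<in> {c..d}) \<longrightarrow>
      (\<integral>y. f y \<partial>\<mu>) \<in> {c..d})"
proof -
  \<comment> \<open>The value 0 off \<open>local_sets\<close> puts every \<open>a n\<close> into the
    cube of functions from sets to [0,1], which is compact by Tychonoff; \<open>l\<close> will be a
    cluster point there.\<close>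
  define a :: "nat \<Rightarrow> (nat \<Rightarrow> 'a) set \<Rightarrow> real" where
    "a n C = (if C \<in> local_sets then orbit_average x n (indicator C) else 0)" for n C
  have ind: "\<exists>S. finite S \<and> depends_on S (indicator C :: _ \<Rightarrow> real)" if "C \<in> local_sets" for C :: "(nat \<Rightarrow> 'a) set"
    using that depends_on_comp[where h = "of_bool :: bool \<Rightarrow> real"]
    by (auto simp: local_sets_def indicator_def[abs_def])
  have ind01: "orbit_average x n (indicator C) \<in> {0..1}" if "C \<in> local_sets" for C n
  proof (rule orbit_average_bounds)
    obtain S where "finite S" "depends_on S (indicator C :: _ \<Rightarrow> real)" using ind[OF \<open>C \<in> local_sets\<close>] by blast
    from Pn_ge[OF this, of 0] Pn_le[OF this, of 1] show "(P ^^ t) (indicator C) x \<in> {0..1}" for t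
      by simp
  qed
  let ?B = "(UNIV :: (nat \<Rightarrow> 'a) set set) \<rightarrow>\<^sub>E {0..1::real}"
  have "compactin (product_topology (\<lambda>_. euclidean) (UNIV :: (nat \<Rightarrow> 'a) set set)) ?B"
    by (simp add: compactin_PiE)
  then have "compact ?B"
    by (simp add: euclidean_product_topology)
  moreover have "\<forall>\<^sub>F c in filtermap a sequentially. c \<in> ?B"
    using ind01 by (auto simp: eventually_filtermap a_def PiE_iff)
  moreover have "filtermap a sequentially \<noteq> bot"
    by (simp add: filtermap_bot_iff)
  ultimately obtain l where l: "inf (nhds l) (filtermap a sequentially) \<noteq> bot"
    unfolding compact_filter by blast
  \<comment> \<open>This filter plays the role of a subsequence: it refines
    \<open>sequentially\<close>, and \<open>a\<close> converges to \<open>l\<close> along it. It is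
    proper because \<open>l\<close> is a cluster point.\<close>
  define \<F> where "\<F> = inf (filtercomap a (nhds l)) sequentially"
  have F0: "\<F> \<noteq> bot"
  proof
    assume "\<F> = bot"
    then have "eventually (\<lambda>_. False) \<F>" by simp
    then obtain Q R where QR: "eventually Q (filtercomap a (nhds l))" "eventually R sequentially"
      "\<And>n. Q n \<Longrightarrow> R n \<Longrightarrow> False"
      unfolding \<F>_def eventually_inf by blast
    then obtain Q' where Q': "eventually Q' (nhds l)" "\<And>n. Q' (a n) \<Longrightarrow> Q n"
      unfolding eventually_filtercomap by blast
    have "eventually (\<lambda>c. \<not> Q' c) (filtermap a sequentially)"
      unfolding eventually_filtermap using QR(2) by eventually_elim (use QR(3) Q'(2) in blast)
    with Q'(1) have "eventually (\<lambda>_. False) (inf (nhds l) (filtermap a sequentially))"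
      unfolding eventually_inf by blast
    with l show False by (simp add: eventually_False)
  qed
  have Fseq: "filterlim (\<lambda>n. n) sequentially \<F>"
    unfolding \<F>_def filterlim_def by simp
  have "(a \<longlongrightarrow> l) \<F>"
    unfolding \<F>_def by (rule filterlim_mono[OF filterlim_filtercomap order_refl]) simp
  then have lim_a: "((\<lambda>n. a n C) \<longlongrightarrow> l C) \<F>" for C
  proof (intro topological_tendstoI)
    fix S :: "real set" assume "open S" "l C \<in> S"
    have "open ((\<lambda>c. c C) -` S)"
      by (rule open_vimage[OF \<open>open S\<close> continuous_on_product_coordinates])
    with \<open>(a \<longlongrightarrow> l) \<F>\<close> \<open>l C \<in> S\<close> have "\<forall>\<^sub>F n in \<F>. a n \<in> (\<lambda>c. c C) -` S"
      by (intro topological_tendstoD) auto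
    then show "\<forall>\<^sub>F n in \<F>. a n C \<in> S" by simp
  qed
  have lim: "((\<lambda>n. orbit_average x n (indicator C)) \<longlongrightarrow> l C) \<F>" if "C \<in> local_sets" for C
    using lim_a[of C] that by (simp add: a_def)
  have "\<exists>\<mu>. prob_config \<mu> \<and> (\<forall>C\<in>local_sets. measure \<mu> C = l C)"
  proof (rule local_charge_extends)
    show "0 \<le> l C" if "C \<in> local_sets" for C
      by (rule tendsto_lowerbound[OF lim[OF that] _ F0]) (use ind01[OF that] in simp)
    show "l (C \<union> D) = l C + l D" if C: "C \<in> local_sets" and D: "D \<in> local_sets" and CD: "C \<inter> D = {}" for C D
    proof -
      obtain S T where ST: "finite S" "depends_on S (indicator C :: _ \<Rightarrow> real)" "finite T" "depends_on T (indicator D :: _ \<Rightarrow> real)"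
        using ind[OF C] ind[OF D] by blast
      have "indicator (C \<union> D) = (\<lambda>x. indicator C x + indicator D x :: real)"
        using CD by (auto simp: fun_eq_iff indicator_def)
      then have eq: "orbit_average x n (indicator (C \<union> D)) = orbit_average x n (indicator C) + orbit_average x n (indicator D)" for n
        using orbit_average_add[OF ST] by simp
      have "C \<union> D \<in> local_sets"
        using algebra.axioms(1)[OF algebra_local_sets] C D by (intro ring_of_sets.Un) auto
      from lim[OF this] show ?thesis
        unfolding eq by (rule tendsto_unique[OF F0]) (intro tendsto_add lim C D)
    qed
    have U: "UNIV \<in> (local_sets :: (nat \<Rightarrow> 'a) set set)" by (rule algebra.top[OF algebra_local_sets])
    show "l UNIV = 1"
      using lim[OF U] orbit_average_const[of x _ 1] by (intro tendsto_unique[OF F0]) (auto simp: indicator_def)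
  qed
  then obtain \<mu> where \<mu>: "prob_config \<mu>" and \<mu>l: "\<And>C. C \<in> local_sets \<Longrightarrow> measure \<mu> C = l C" by blast
  interpret \<mu>: prob_config \<mu> by fact
  have lim_integral: "((\<lambda>n. orbit_average x n f) \<longlongrightarrow> (\<integral>y. f y \<partial>\<mu>)) \<F>" if S: "finite S" "depends_on S f" for S f
  proof -
    have dep: "depends_on S (\<lambda>y. f w * indicator (cylinder S w) y)" for w
      by (rule depends_onI) (auto simp: cylinder_def indicator_def)
    have fin: "finite (S \<rightarrow>\<^sub>E (UNIV :: 'a set))" using S(1) by (intro finite_PiE) auto
    have "f = (\<lambda>y. \<Sum>w\<in>S \<rightarrow>\<^sub>E UNIV. f w * indicator (cylinder S w) y)"
      using local_expansion[OF S] by blast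
    then have "orbit_average x n f = orbit_average x n (\<lambda>y. \<Sum>w\<in>S \<rightarrow>\<^sub>E UNIV. f w * indicator (cylinder S w) y)" for n
      by simp
    also have "\<dots> n = (\<Sum>w\<in>S \<rightarrow>\<^sub>E UNIV. f w * orbit_average x n (indicator (cylinder S w)))" for n
      by (subst orbit_average_sum[OF fin S(1) dep]) (simp add: orbit_average_cmult)
    finally show ?thesis
      unfolding \<mu>.integral_local[OF S]
      by (auto intro!: tendsto_sum tendsto_mult lim simp: \<mu>l cylinder_in_local_sets S(1))
  qed
  have "invariant_measure K \<mu>"
  proof (rule invariant_measureI[OF \<mu>])
    fix S :: "nat set" and w :: "nat \<Rightarrow> 'a" assume S: "finite S"
    let ?f = "indicator (cylinder S w) :: (nat \<Rightarrow> 'a) \<Rightarrow> real"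
    have dep: "depends_on S ?f"
      by (rule depends_on_cylinder)
    obtain T where T: "finite T" "depends_on T (P ?f)" using P_local[OF S dep] by blast
    \<comment> \<open>The boundary terms of the telescoping are at most 1 / (n + 1).\<close>
    have "((\<lambda>n. ((P ^^ Suc n) ?f x - ?f x) / real (Suc n)) \<longlongrightarrow> 0) sequentially"
    proof (rule tendsto_rabs_zero_cancel, rule tendsto_sandwich[OF _ _ tendsto_const LIMSEQ_inverse_real_of_nat])
      have "0 \<le> (P ^^ t) ?f x" "(P ^^ t) ?f x \<le> 1" for t
        using Pn_ge[OF S dep, of 0] Pn_le[OF S dep, of 1] by simp_all
      from this[of "Suc _"] this[of 0] have "\<bar>(P ^^ Suc n) ?f x - ?f x\<bar> \<le> 1" for n
        unfolding abs_le_iff funpow_0 by (smt (verit))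
      then show "\<forall>\<^sub>F n in sequentially. \<bar>((P ^^ Suc n) ?f x - ?f x) / real (Suc n)\<bar> \<le> inverse (real (Suc n))"
        unfolding abs_divide inverse_eq_divide abs_of_nat
        by (intro always_eventually allI divide_right_mono) (auto simp del: funpow.simps)
    qed simp
    then have 0: "((\<lambda>n. ((P ^^ Suc n) ?f x - ?f x) / real (Suc n)) \<longlongrightarrow> 0) \<F>"
      by (rule filterlim_compose[OF _ Fseq])
    \<comment> \<open>The averages of \<open>P ?f\<close> converge to the integral of
      \<open>P ?f\<close>, and by telescoping also to that of \<open>?f\<close>.\<close>
    have "((\<lambda>n. orbit_average x n (P ?f)) \<longlongrightarrow> (\<integral>y. ?f y \<partial>\<mu>) + 0) \<F>"
      unfolding orbit_average_P by (intro tendsto_add lim_integral[OF S dep] 0)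
    from tendsto_unique[OF F0 lim_integral[OF T] this]
    show "(\<integral>x. P ?f x \<partial>\<mu>) = measure \<mu> (cylinder S w)"
      by (simp add: \<mu>.space_eq)
  qed
  moreover have "(\<integral>y. f y \<partial>\<mu>) \<in> {c..d}"
    if S: "finite S" "depends_on S f" and b: "\<And>t. (P ^^ t) f x \<in> {c..d}" for S f c d
    using tendsto_lowerbound[OF lim_integral[OF S] _ F0, of c] tendsto_upperbound[OF lim_integral[OF S] _ F0, of d]
      orbit_average_bounds[OF b] by simp
  ultimately show ?thesis by blast
qed

text \<open>The invariant measures obtained from the orbits of \<open>x\<close> and of
  \<open>y\<close> give \<open>f\<close> different integrals. The bounds \<open>l\<close> and
  \<open>u\<close> only complete the one-sided estimates to intervals.\<close>

lemma not_uniquely_ergodic: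
  assumes S: "finite S" "depends_on S f" and "\<And>x. f x \<in> {l..u}"
    and lo: "\<And>t. (P ^^ t) f x \<le> c" and hi: "\<And>t. d \<le> (P ^^ t) f y" and "c < d"
  shows "\<epsilon> \<notin> Uni F"
proof
  assume "\<epsilon> \<in> Uni F"
  then have uniq: "\<mu> = \<nu>" if "invariant_measure K \<mu>" "invariant_measure K \<nu>" for \<mu> \<nu>
    using that by (auto simp: Uni_def)
  have b: "l \<le> (P ^^ t) f z" "(P ^^ t) f z \<le> u" for t z
    using Pn_ge[OF S, of l] Pn_le[OF S, of u] assms(3) by auto
  obtain \<mu> where \<mu>: "invariant_measure K \<mu>" "(\<integral>y. f y \<partial>\<mu>) \<in> {l..c}"
    using ex_invariant_measure[of x] S lo b by (metis atLeastAtMost_iff)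
  obtain \<nu> where \<nu>: "invariant_measure K \<nu>" "(\<integral>y. f y \<partial>\<nu>) \<in> {d..u}"
    using ex_invariant_measure[of y] S hi b by (metis atLeastAtMost_iff)
  show False
    using uniq[OF \<mu>(1) \<nu>(1)] \<mu>(2) \<nu>(2) \<open>c < d\<close> by simp
qed

section \<open>Uniqueness from loss of memory\<close>

definition forgets :: "((nat \<Rightarrow> 'a) \<Rightarrow> real) \<Rightarrow> bool" where
  "forgets f \<longleftrightarrow> (\<forall>\<eta>>0. \<exists>t. \<forall>x y. (P ^^ t) f x - (P ^^ t) f y \<le> \<eta>)"

text \<open>Two invariant measures integrate \<open>(P ^^ t) f\<close> to the same values as
  \<open>f\<close>, and these integrals differ by at most the oscillation of
  \<open>(P ^^ t) f\<close>. One inequality between the measures suffices, by symmetry.\<close>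

lemma uniquely_ergodic:
  assumes "\<And>S f. finite S \<Longrightarrow> depends_on S f \<Longrightarrow> (\<And>x. f x \<in> {0..1}) \<Longrightarrow> forgets f"
  shows "\<epsilon> \<in> Uni F"
proof -
  have le: "measure \<mu> (cylinder U w) \<le> measure \<nu> (cylinder U w)"
    if \<mu>: "invariant_measure K \<mu>" and \<nu>: "invariant_measure K \<nu>" and U: "finite U" for \<mu> \<nu> U w
  proof (rule field_le_epsilon)
    interpret \<mu>: prob_config \<mu> using \<mu> by (simp add: prob_config_iff invariant_measure_def)
    interpret \<nu>: prob_config \<nu> using \<nu> by (simp add: prob_config_iff invariant_measure_def)
    fix \<eta> :: real assume "\<eta> > 0"
    let ?f = "indicator (cylinder U w) :: (nat \<Rightarrow> 'a) \<Rightarrow> real"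
    have dep: "depends_on U ?f"
      by (rule depends_on_cylinder)
    have "forgets ?f" by (rule assms[OF U dep]) simp
    then obtain t where t: "\<And>x y. (P ^^ t) ?f x - (P ^^ t) ?f y \<le> \<eta>"
      using \<open>\<eta> > 0\<close> unfolding forgets_def by blast
    obtain T where T: "finite T" "depends_on T ((P ^^ t) ?f)" using Pn_local[OF U dep] by blast
    have "(P ^^ t) ?f x \<le> measure \<nu> (cylinder U w) + \<eta>" for x
    proof -
      have "(\<integral>y. (P ^^ t) ?f x \<partial>\<nu>) \<le> (\<integral>y. (P ^^ t) ?f y + \<eta> \<partial>\<nu>)"
        using t \<nu>.integrable_local[OF T] by (intro integral_mono) (auto simp: algebra_simps)
      also have "\<dots> = measure \<nu> (cylinder U w) + \<eta>"
        using \<nu>.integrable_local[OF T] integral_invariant_Pn[OF \<nu> U dep, of t]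
        by (simp add: \<nu>.space_eq \<nu>.prob_UNIV)
      finally show ?thesis by (simp add: \<nu>.space_eq \<nu>.prob_UNIV)
    qed
    then have "(\<integral>x. (P ^^ t) ?f x \<partial>\<mu>) \<le> (\<integral>x. measure \<nu> (cylinder U w) + \<eta> \<partial>\<mu>)"
      using \<mu>.integrable_local[OF T] by (intro integral_mono) auto
    then show "measure \<mu> (cylinder U w) \<le> measure \<nu> (cylinder U w) + \<eta>"
      using integral_invariant_Pn[OF \<mu> U dep, of t] by (simp add: \<mu>.space_eq \<mu>.prob_UNIV)
  qed
  have "\<mu> = \<nu>" if "invariant_measure K \<mu>" "invariant_measure K \<nu>" for \<mu> \<nu>
    using that by (intro prob_config_eqI antisym le) (auto simp: prob_config_iff invariant_measure_def)
  moreover have "\<exists>\<mu>. invariant_measure K \<mu>" using ex_invariant_measure by blast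
  ultimately show ?thesis
    using eps by (auto simp: Uni_def)
qed

end

section \<open>Refreshing finitely many coordinates\<close>

text \<open>The effect on \<open>f\<close> of resampling coordinate \<open>i\<close>
  uniformly.\<close>

definition coord_average :: "nat \<Rightarrow> ((nat \<Rightarrow> 'a::finite) \<Rightarrow> real) \<Rightarrow> (nat \<Rightarrow> 'a) \<Rightarrow> real" where
  "coord_average i f x = (\<Sum>b\<in>UNIV. f (x(i := b))) / real CARD('a)"

primrec head_average :: "nat \<Rightarrow> ((nat \<Rightarrow> 'a::finite) \<Rightarrow> real) \<Rightarrow> (nat \<Rightarrow> 'a) \<Rightarrow> real" where
  "head_average 0 f = f"
| "head_average (Suc i) f = coord_average i (head_average i f)"

lemma coord_average_depends: "depends_on S f \<Longrightarrow> depends_on (S - {i}) (coord_average i f)"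
  unfolding coord_average_def
  by (intro depends_onI arg_cong2[where f = "(/)"] sum.cong refl) (erule depends_onD, auto)

lemma coord_average_bounds:
  fixes f :: "(nat \<Rightarrow> 'a::finite) \<Rightarrow> real"
  assumes "\<And>x. f x \<in> {c..d}"
  shows "coord_average i f x \<in> {c..d}"
proof -
  have "(\<Sum>b\<in>(UNIV :: 'a set). c) \<le> (\<Sum>b\<in>UNIV. f (x(i := b)))"
    "(\<Sum>b\<in>UNIV. f (x(i := b))) \<le> (\<Sum>b\<in>(UNIV :: 'a set). d)"
    using assms by (intro sum_mono; simp)+
  then show ?thesis
    by (simp add: coord_average_def field_simps)
qed

lemma head_average_depends: "depends_on S f \<Longrightarrow> depends_on (S - {..<h}) (head_average h f)"
proof (induction h)
  case (Suc h)
  have "S - {..<Suc h} = S - {..<h} - {h}" by auto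
  with coord_average_depends[OF Suc.IH[OF Suc.prems], of h] show ?case
    by (simp only: head_average.simps)
qed simp

lemma head_average_bounds: "(\<And>x. f x \<in> {c..d}) \<Longrightarrow> head_average h f x \<in> {c..d}"
proof (induction h arbitrary: x)
  case (Suc h)
  then show ?case unfolding head_average.simps by (intro coord_average_bounds) blast
qed simp

lemma head_average_diff: "head_average h (\<lambda>x. c - f x) = (\<lambda>x. c - head_average h f x)"
  by (induction h) (auto simp: coord_average_def sum_subtractf diff_divide_distrib)

context perturbed_map
begin

lemma P_coord_average:
  assumes S: "finite S" "depends_on S f" and nn: "\<And>x. 0 \<le> f x"
  shows "\<epsilon> * P (coord_average i f) x \<le> P f x"
proof -
  define T where "T = insert i S"
  have T: "finite T" "depends_on T f" "i \<in> T"
    using S by (auto simp: T_def elim: depends_on_mono)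
  let ?q = "real CARD('a)"
  let ?W = "T \<rightarrow>\<^sub>E (UNIV :: 'a set)"
  have fin: "finite ?W" using T(1) by (intro finite_PiE) auto
  \<comment> \<open>The contribution of the pattern \<open>w\<close> to the average. It no longer
    reads coordinate \<open>i\<close>: summing over the letter at \<open>i\<close> leaves the
    cylinder on \<open>T - {i}\<close>.\<close>
  define g where "g w y = f w * (indicator (cylinder (T - {i}) w) y / ?q)" for w y
  have g: "depends_on (T - {i}) (g w)" for w
    unfolding g_def by (rule depends_onI) (auto simp: cylinder_def indicator_def)
  have avg: "coord_average i f = (\<lambda>y. \<Sum>w\<in>?W. g w y)"
  proof
    fix y :: "nat \<Rightarrow> 'a"
    have "(\<Sum>b\<in>UNIV. indicator (cylinder T w) (y(i := b))) = (indicator (cylinder (T - {i}) w) y :: real)" for w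
    proof -
      have "(\<Sum>b\<in>UNIV. indicator (cylinder T w) (y(i := b)) :: real) =
          (\<Sum>b\<in>UNIV. if b = w i then indicator (cylinder (T - {i}) w) y else 0)"
        using T(3) by (intro sum.cong refl) (auto simp: cylinder_def indicator_def)
      then show ?thesis by simp
    qed
    note key = this
    have "(\<Sum>w\<in>?W. g w y) = (\<Sum>w\<in>?W. \<Sum>b\<in>UNIV. f w * indicator (cylinder T w) (y(i := b)) / ?q)"
      by (simp only: g_def key[symmetric] times_divide_eq_right sum_distrib_left sum_divide_distrib)
    also have "\<dots> = (\<Sum>b\<in>UNIV. (\<Sum>w\<in>?W. f w * indicator (cylinder T w) (y(i := b))) / ?q)"
      by (subst sum.swap) (simp add: sum_divide_distrib)
    also have "\<dots> = coord_average i f y"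
      unfolding local_expansion[OF T(1,2), symmetric] coord_average_def by (simp add: sum_divide_distrib)
    finally show "coord_average i f y = (\<Sum>w\<in>?W. g w y)" by simp
  qed
  have Pg: "P (g w) x = f w * ((\<Prod>j\<in>T - {i}. noise \<epsilon> (F x j) (w j)) / ?q)" for w
  proof -
    have "P (g w) x = f w * (1 / ?q) * P (indicator (cylinder (T - {i}) w)) x"
      unfolding P_cmult[THEN fun_cong, symmetric] by (simp add: g_def[abs_def])
    then show ?thesis
      using T(1) by (simp add: P_indicator measure_cylinder)
  qed
  have "\<epsilon> * P (coord_average i f) x = (\<Sum>w\<in>?W. f w * (\<epsilon> / ?q * (\<Prod>j\<in>T - {i}. noise \<epsilon> (F x j) (w j))))"
    unfolding avg using P_sum[of ?W "\<lambda>_. T - {i}" g] g T(1) by (simp add: Pg sum_distrib_left mult_ac)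
  also have "\<dots> \<le> (\<Sum>w\<in>?W. f w * (noise \<epsilon> (F x i) (w i) * (\<Prod>j\<in>T - {i}. noise \<epsilon> (F x j) (w j))))"
  proof (intro sum_mono mult_left_mono mult_right_mono nn prod_nonneg)
    show "\<epsilon> / ?q \<le> noise \<epsilon> (F x i) (w i)" for w :: "nat \<Rightarrow> 'a"
      using eps by (simp add: noise_def)
  qed (use eps in \<open>simp add: noise_nonneg\<close>)
  also have "\<dots> = P f x"
    unfolding P_expansion[OF T(1,2)] by (simp add: prod.remove[OF T(1,3)])
  finally show ?thesis .
qed

lemma P_head_average:
  assumes S: "finite S" "depends_on S f" and b: "\<And>x. f x \<in> {0..1}"
  shows "\<epsilon> ^ h * P (head_average h f) x \<le> P f x"
proof (induction h)
  case (Suc h)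
  have "depends_on S (head_average h f)"
    using head_average_depends[OF S(2)] by (rule depends_on_mono) auto
  then have "\<epsilon> * P (head_average (Suc h) f) x \<le> P (head_average h f) x"
    unfolding head_average.simps using head_average_bounds[of f 0 1 h] b
    by (intro P_coord_average[OF S(1)]) auto
  then have "\<epsilon> ^ h * (\<epsilon> * P (head_average (Suc h) f) x) \<le> \<epsilon> ^ h * P (head_average h f) x"
    using eps by (intro mult_left_mono) auto
  with Suc show ?case by (simp add: mult_ac)
qed simp

text \<open>With probability at least \<open>\<epsilon> ^ h\<close> all coordinates below \<open>h\<close> are refreshed at once.\<close>

lemma refresh_decomposition:
  assumes S: "finite S" "depends_on S f" and b: "\<And>x. f x \<in> {0..1}"
    and T: "finite T" "depends_on T (P f)" "depends_on T (P (head_average h f))"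
  shows "\<exists>g. depends_on T g \<and> (\<forall>x. g x \<in> {0..1}) \<and>
    P f = (\<lambda>x. \<epsilon> ^ h * P (head_average h f) x + (1 - \<epsilon> ^ h) * g x)"
proof -
  let ?c = "\<epsilon> ^ h" and ?A = "head_average h f"
  have A: "depends_on S ?A"
    using head_average_depends[OF S(2)] by (rule depends_on_mono) auto
  have c: "0 \<le> ?c" "?c \<le> 1" using eps by (auto simp: power_le_one)
  have lo: "?c * P ?A x \<le> P f x" for x by (rule P_head_average[OF S b])
  \<comment> \<open>The upper bound is the lower bound applied to \<open>1 - f\<close>.\<close>
  have "?c * P (head_average h (\<lambda>x. 1 - f x)) x \<le> P (\<lambda>x. 1 - f x) x" for x
    using b by (intro P_head_average[OF S(1)] depends_on_comp[OF S(2)]) auto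
  then have hi: "P f x \<le> ?c * P ?A x + (1 - ?c)" for x
    unfolding head_average_diff P_diff[OF finite.emptyI depends_on_const S] P_diff[OF finite.emptyI depends_on_const S(1) A] P_const
    by (simp add: algebra_simps)
  show ?thesis
  proof (cases "?c = 1")
    \<comment> \<open>No mass remains outside the refreshed part, so the quotient defining
      \<open>g\<close> below would divide by zero; any \<open>g\<close> with values in [0,1]
      serves.\<close>
    case True
    have "P f = P ?A" using lo hi True by (intro ext antisym) auto
    then show ?thesis using True by (intro exI[of _ "\<lambda>_. 0"]) (simp add: depends_on_const)
  next
    case False
    then have c1: "?c < 1" using c by simp
    define g where "g x = (P f x - ?c * P ?A x) / (1 - ?c)" for x
    have "depends_on T g"
      unfolding g_def by (rule depends_on_comp2[OF T(2,3)])
    moreover have "g x \<in> {0..1}" for x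
      using lo[of x] hi[of x] c1 by (auto simp: g_def field_simps)
    moreover have "P f = (\<lambda>x. ?c * P ?A x + (1 - ?c) * g x)"
      using c1 by (auto simp: g_def)
    ultimately show ?thesis by blast
  qed
qed

lemma forgetsD:
  assumes "forgets f" "finite S" "depends_on S f" "\<eta> > 0"
  shows "\<exists>t0. \<forall>t\<ge>t0. \<forall>x y. (P ^^ t) f x - (P ^^ t) f y \<le> \<eta>"
proof -
  obtain t0 where "\<And>x y. (P ^^ t0) f x - (P ^^ t0) f y \<le> \<eta>"
    using assms(1,4) unfolding forgets_def by blast
  then show ?thesis
    using Pn_oscillation_antimono[OF assms(2,3), of t0 \<eta>] by blast
qed

text \<open>Doeblin's argument. With weight \<open>\<epsilon> ^ h\<close> the head is resampled, and
  what is left is a function of the tail, which forgets. The other weight multiplies a local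
  function into [0,1], which can be split again; after \<open>s\<close> rounds only
  \<open>(1 - \<epsilon> ^ h) ^ s\<close> is undecided. For \<open>h = 0\<close> the weight is 1,
  even when \<open>\<epsilon> = 0\<close>.\<close>

lemma forgets_of_tail:
  assumes tail: "\<And>S f. finite S \<Longrightarrow> S \<inter> {..<h} = {} \<Longrightarrow> depends_on S f \<Longrightarrow> (\<And>x. f x \<in> {0..1}) \<Longrightarrow> forgets f"
    and c: "\<epsilon> > 0 \<or> h = 0"
    and S: "finite S" "depends_on S f" and b: "\<And>x. f x \<in> {0..1}"
  shows "forgets f"
  unfolding forgets_def
proof (intro allI impI)
  let ?c = "\<epsilon> ^ h"
  have c01: "0 < ?c" "?c \<le> 1" using eps c by (auto simp: power_le_one)
  \<comment> \<open>The function and its support vary in the induction because the remainder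
    \<open>g\<close> of each round reads other coordinates than \<open>f\<close>.\<close>
  have *: "\<exists>t. \<forall>x y. (P ^^ t) f x - (P ^^ t) f y \<le> (1 - ?c) ^ s + \<eta>"
    if "\<eta> > 0" "finite S" "depends_on S f" "\<And>x. f x \<in> {0..1}" for s \<eta> S f
    using that
  proof (induction s arbitrary: S f)
    case 0
    have "f x - f y \<le> 1 + \<eta>" for x y
      using 0(4)[of x] 0(4)[of y] 0(1) by auto
    then show ?case by (intro exI[of _ 0]) simp
  next
    case (Suc s)
    note S = Suc.prems(2,3) and b = Suc.prems(4)
    let ?A = "head_average h f"
    have A: "depends_on S ?A"
      using head_average_depends[OF S(2)] by (rule depends_on_mono) auto
    obtain m1 where m1: "depends_on {..<m1} (P f)" using P_local[OF S] by blast
    obtain m2 where m2: "depends_on {..<m2} (P ?A)" using P_local[OF S(1) A] by blast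
    define T where "T = {..<max m1 m2}"
    have T: "finite T" "depends_on T (P f)" "depends_on T (P ?A)"
      using m1 m2 by (auto simp: T_def elim!: depends_on_mono)
    obtain g where g: "depends_on T g" "\<And>x. g x \<in> {0..1}"
      and Pf: "P f = (\<lambda>x. ?c * P ?A x + (1 - ?c) * g x)"
      using refresh_decomposition[OF S b T] by blast
    have "forgets ?A"
      using S(1) head_average_bounds[of f 0 1] b
      by (intro tail[OF _ _ head_average_depends[OF S(2)]]) auto
    then obtain t1 where t1: "\<And>t x y. t \<ge> t1 \<Longrightarrow> (P ^^ t) ?A x - (P ^^ t) ?A y \<le> \<eta>"
      using forgetsD[OF _ S(1) A Suc.prems(1)] by blast
    obtain t2 where t2: "\<And>x y. (P ^^ t2) g x - (P ^^ t2) g y \<le> (1 - ?c) ^ s + \<eta>"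
      using Suc.IH[OF Suc.prems(1) T(1) g(1)] g(2) by blast
    define t where "t = max t1 t2"
    have "(P ^^ Suc t) f x - (P ^^ Suc t) f y \<le> (1 - ?c) ^ Suc s + \<eta>" for x y
    proof -
      have Pt: "(P ^^ Suc t) f = (\<lambda>x. ?c * (P ^^ Suc t) ?A x + (1 - ?c) * (P ^^ t) g x)"
      proof -
        have "(P ^^ Suc t) f = (P ^^ t) (\<lambda>x. ?c * P ?A x + (1 - ?c) * g x)"
          by (simp only: funpow_Suc_right o_apply Pf)
        also have "\<dots> = (\<lambda>x. (P ^^ t) (\<lambda>x. ?c * P ?A x) x + (P ^^ t) (\<lambda>x. (1 - ?c) * g x) x)"
          by (rule Pn_add[OF T(1) depends_on_comp[OF T(3)] T(1) depends_on_comp[OF g(1)]])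
        finally show ?thesis
          by (simp only: Pn_cmult funpow_Suc_right o_apply)
      qed
      \<comment> \<open>The weights sum to 1, so the tolerance \<eta> does not accumulate over the
        rounds.\<close>
      have "?c * ((P ^^ Suc t) ?A x - (P ^^ Suc t) ?A y) \<le> ?c * \<eta>"
        using c01 by (intro mult_left_mono t1) (auto simp: t_def)
      moreover have "(1 - ?c) * ((P ^^ t) g x - (P ^^ t) g y) \<le> (1 - ?c) * ((1 - ?c) ^ s + \<eta>)"
        using c01 by (intro mult_left_mono Pn_oscillation_antimono[OF T(1) g(1) t2]) (auto simp: t_def)
      ultimately show ?thesis
        unfolding Pt by (simp add: algebra_simps)
    qed
    then show ?case by blast
  qed
  fix \<eta> :: real assume "\<eta> > 0"
  obtain s where "(1 - ?c) ^ s < \<eta> / 2"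
    using real_arch_pow_inv[of "\<eta> / 2" "1 - ?c"] \<open>\<eta> > 0\<close> c01 by auto
  moreover obtain t where t: "\<And>x y. (P ^^ t) f x - (P ^^ t) f y \<le> (1 - ?c) ^ s + \<eta> / 2"
    using *[of "\<eta> / 2" S f s] S b \<open>\<eta> > 0\<close> by auto
  ultimately have "(P ^^ t) f x - (P ^^ t) f y \<le> \<eta>" for x y
    using t[of x y] by linarith
  then show "\<exists>t. \<forall>x y. (P ^^ t) f x - (P ^^ t) f y \<le> \<eta>" by blast
qed

text \<open>Resampling the whole head turns \<open>f\<close> into a constant, and the remainder is
  again a function of the head. Each step thus contracts by \<open>1 - \<epsilon> ^ h\<close>, at a
  rate uniform in \<open>f\<close>.\<close>

lemma closed_head_oscillation:
  assumes closed: "\<And>i. i < h \<Longrightarrow> depends_on {..<h} (\<lambda>x. F x i)"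
    and f: "depends_on {..<h} f" "\<And>x. f x \<in> {0..1}"
  shows "(P ^^ t) f x - (P ^^ t) f y \<le> (1 - \<epsilon> ^ h) ^ t"
  using f
proof (induction t arbitrary: f x y)
  case 0
  show ?case
    using 0(2)[of x] 0(2)[of y] unfolding atLeastAtMost_iff power_0 funpow_0 by linarith
next
  case (Suc t)
  let ?c = "\<epsilon> ^ h" and ?A = "head_average h f"
  have c01: "?c \<le> 1" using eps by (auto simp: power_le_one)
  have A: "depends_on {} ?A" using head_average_depends[OF Suc.prems(1), of h] by simp
  then have "depends_on {..<h} ?A" by (rule depends_on_mono) simp
  then obtain g where g: "depends_on {..<h} g" "\<And>x. g x \<in> {0..1}"
      and Pf: "P f = (\<lambda>x. ?c * P ?A x + (1 - ?c) * g x)"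
    using refresh_decomposition[OF finite_lessThan Suc.prems finite_lessThan, of h h]
      P_depends[OF finite_lessThan _ closed] Suc.prems(1) by force
  obtain k where k: "?A = (\<lambda>x. k)"
    using depends_onD[OF A] by (metis empty_iff)
  have "(P ^^ Suc t) f = (P ^^ t) (\<lambda>x. ?c * k + (1 - ?c) * g x)"
    by (simp only: funpow_Suc_right o_apply Pf k P_const)
  also have "\<dots> = (\<lambda>x. (P ^^ t) (\<lambda>x. ?c * k) x + (P ^^ t) (\<lambda>x. (1 - ?c) * g x) x)"
    by (rule Pn_add[OF finite.emptyI depends_on_const finite_lessThan depends_on_comp[OF g(1)]])
  also have "\<dots> = (\<lambda>x. ?c * k + (1 - ?c) * (P ^^ t) g x)"
    by (simp only: Pn_cmult Pn_const)
  finally have "(P ^^ Suc t) f x - (P ^^ Suc t) f y = (1 - ?c) * ((P ^^ t) g x - (P ^^ t) g y)"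
    by (simp only: right_diff_distrib)
  also have "\<dots> \<le> (1 - ?c) * (1 - ?c) ^ t"
    using c01 by (intro mult_left_mono Suc.IH[OF g]) auto
  finally show ?case by simp
qed

section \<open>Chebyshev's inequality for letter frequencies\<close>

lemma P_letter:
  "P (\<lambda>y. of_bool (y i = a)) x = noise \<epsilon> (F x i) a"
  using measure_cylinder[of "{i}" x "\<lambda>_. a"] P_indicator[of "cylinder {i} (\<lambda>_. a)"]
  by (simp add: cylinder_def indicator_def[abs_def])

lemma P_two_letters:
  assumes "i \<noteq> j"
  shows "P (\<lambda>y. of_bool (y i = a) * of_bool (y j = a)) x = noise \<epsilon> (F x i) a * noise \<epsilon> (F x j) a"
proof -
  have "(\<lambda>y. of_bool (y i = a) * of_bool (y j = a)) = (indicator (cylinder {i, j} (\<lambda>_. a)) :: _ \<Rightarrow> real)"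
    by (auto simp: cylinder_def indicator_def fun_eq_iff)
  then show ?thesis
    using measure_cylinder[of "{i, j}" x "\<lambda>_. a"] assms by (simp add: P_indicator)
qed

text \<open>After the perturbation the cells of \<open>D\<close> are independent and identically
  distributed, each showing \<open>a\<close> with probability \<open>noise \<epsilon> r a\<close>;
  the variance of the count is at most \<open>card D\<close>.\<close>

lemma frequency_deviation:
  assumes D: "finite D" "D \<noteq> {}" and const: "\<And>i. i \<in> D \<Longrightarrow> F x i = r" and "\<delta> > 0"
    and B: "\<And>y. B y \<Longrightarrow> \<delta> \<le> \<bar>real (card {i\<in>D. y i = a}) / real (card D) - noise \<epsilon> r a\<bar>"
    and depB: "depends_on D B"
  shows "P (\<lambda>y. of_bool (B y)) x \<le> 1 / (real (card D) * \<delta>\<^sup>2)"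
proof -
  let ?p = "noise \<epsilon> r a" and ?N = "real (card D)"
  have N: "?N > 0" using D by (simp add: card_gt_0_iff)
  have p: "0 \<le> ?p" "?p \<le> 1"
    using eps noise_le_1 by (auto simp: noise_nonneg)
  define X where "X i y = (of_bool (y i = a) :: real) - ?p" for i and y :: "nat \<Rightarrow> 'a"
  have Xd: "depends_on D (X i)" if "i \<in> D" for i
    unfolding X_def by (rule depends_onI) (use that in auto)
  have XXd: "depends_on D (\<lambda>y. X i y * X j y)" if "i \<in> D" "j \<in> D" for i j
    using Xd that by (intro depends_on_comp2[where h = "(*)"]) auto
  have ld: "depends_on D (\<lambda>y. of_bool (y i = a) :: real)" if "i \<in> D" for i
    by (rule depends_onI) (use that in auto)
  \<comment> \<open>Distinct cells are uncorrelated, and each variance is at most 1.\<close>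
  have PXX: "P (\<lambda>y. X i y * X j y) x \<le> of_bool (i = j)" if ij: "i \<in> D" "j \<in> D" for i j
  proof (cases "i = j")
    case True
    have "X i y * X i y \<le> 1" for y
      using p by (auto simp: X_def abs_square_le_1[unfolded power2_eq_square] abs_le_iff)
    then show ?thesis using P_le[OF D(1) XXd[OF ij]] True by auto
  next
    case False
    have d2: "depends_on D (\<lambda>y. of_bool (y i = a) * of_bool (y j = a) :: real)"
      using ld ij by (intro depends_on_comp2[where h = "(*)"]) auto
    have d3: "depends_on D (\<lambda>y. ?p * of_bool (y i = a) + ?p * of_bool (y j = a))"
      using ld ij by (intro depends_on_comp2[where h = "(+)"] depends_on_comp[where h = "(*) ?p"]) auto
    have "(\<lambda>y. X i y * X j y) = (\<lambda>y. (of_bool (y i = a) * of_bool (y j = a) + ?p * ?p) - (?p * of_bool (y i = a) + ?p * of_bool (y j = a)))"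
      by (auto simp: X_def fun_eq_iff algebra_simps)
    note XX = this
    have d2': "depends_on D (\<lambda>y. of_bool (y i = a) * of_bool (y j = a) + ?p * ?p)"
      by (rule depends_on_comp[OF d2])
    have "P (\<lambda>y. X i y * X j y) = (\<lambda>x. P (\<lambda>y. of_bool (y i = a) * of_bool (y j = a)) x + ?p * ?p - (?p * P (\<lambda>y. of_bool (y i = a)) x + ?p * P (\<lambda>y. of_bool (y j = a)) x))"
      unfolding XX P_diff[OF D(1) d2' D(1) d3] P_add[OF D(1) d2 finite.emptyI depends_on_const]
        P_add[OF D(1) depends_on_comp[OF ld[OF ij(1)]] D(1) depends_on_comp[OF ld[OF ij(2)]]] P_cmult P_const ..
    then have "P (\<lambda>y. X i y * X j y) x = 0"
      using const ij by (simp add: P_two_letters[OF False] P_letter)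
    then show ?thesis by simp
  qed
  define Z where "Z y = (\<Sum>i\<in>D. X i y)" for y
  have Z: "Z y = real (card {i\<in>D. y i = a}) - ?N * ?p" for y
    using D(1) by (simp add: Z_def X_def sum_subtractf sum.If_cases Int_def of_bool_def)
  have Zd: "depends_on D (\<lambda>y. Z y * Z y)"
    unfolding Z_def by (intro depends_on_comp2[where h = "(*)"] depends_on_sum Xd)
  have "P (\<lambda>y. Z y * Z y) x = (\<Sum>i\<in>D. \<Sum>j\<in>D. P (\<lambda>y. X i y * X j y) x)"
  proof -
    have d: "depends_on D (\<lambda>y. \<Sum>j\<in>D. X i y * X j y)" if "i \<in> D" for i
      by (rule depends_on_sum) (rule XXd[OF that])
    have "(\<lambda>y. Z y * Z y) = (\<lambda>y. \<Sum>i\<in>D. \<Sum>j\<in>D. X i y * X j y)"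
      by (simp add: Z_def sum_product)
    then show ?thesis
      using P_sum[of D "\<lambda>_. D" "\<lambda>i y. \<Sum>j\<in>D. X i y * X j y"] d D(1) XXd P_sum[of D "\<lambda>_. D"] by simp
  qed
  also have "\<dots> \<le> (\<Sum>i\<in>D. \<Sum>j\<in>D. of_bool (i = j))"
    by (intro sum_mono PXX)
  also have "\<dots> = ?N" using D(1) by (simp add: of_bool_def)
  finally have PZ: "P (\<lambda>y. Z y * Z y) x \<le> ?N" .
  let ?C = "1 / (?N\<^sup>2 * \<delta>\<^sup>2)"
  \<comment> \<open>Markov's inequality for the square of the centred count
    \<open>Z\<close>.\<close>
  have "of_bool (B y) \<le> ?C * (Z y * Z y)" for y
  proof (cases "B y")
    case True
    have "Z y = ?N * (real (card {i\<in>D. y i = a}) / ?N - ?p)"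
      using N by (simp add: Z field_simps)
    then have "\<bar>Z y\<bar> \<ge> ?N * \<delta>"
      using B[OF True] N by (simp add: abs_mult)
    then have "(?N * \<delta>)\<^sup>2 \<le> \<bar>Z y\<bar>\<^sup>2"
      using N \<open>\<delta> > 0\<close> by (intro power_mono) auto
    then show ?thesis
      using True N \<open>\<delta> > 0\<close> by (simp add: field_simps power2_eq_square)
  qed simp
  then have "P (\<lambda>y. of_bool (B y)) x \<le> P (\<lambda>y. ?C * (Z y * Z y)) x"
    by (intro P_mono[OF D(1) _ D(1)] depends_on_comp[OF depB] depends_on_comp[OF Zd])
  also have "\<dots> \<le> ?C * ?N"
    unfolding P_cmult using PZ by (intro mult_left_mono) auto
  also have "\<dots> = 1 / (?N * \<delta>\<^sup>2)"
    using N by (simp add: power2_eq_square)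
  finally show ?thesis .
qed

end

section \<open>Chains of blocks\<close>

text \<open>Chosen so that the Chebyshev bound for a deviation of \<open>1 / (k + 1)\<close> is \<open>1 / 2 ^ k\<close>.\<close>

definition block_size :: "nat \<Rightarrow> nat" where
  "block_size k = (k + 1)\<^sup>2 * 2 ^ k"

lemma block_size_pos: "0 < block_size k"
  by (simp add: block_size_def)

text \<open>\<open>F\<^sub>0\<close> is the map to be kept on the first \<open>h\<close>
  coordinates. The set \<open>C n\<close> contains the noise levels at which the \<open>n\<close>-th
  chain is to keep its memory; 1 is excluded because full noise erases every letter.\<close>

locale chain_system =
  fixes F\<^sub>0 :: "(nat \<Rightarrow> 'a::{finite, discrete_topology}) \<Rightarrow> nat \<Rightarrow> 'a"
    and h :: nat and a b :: 'a and C :: "nat \<Rightarrow> real set"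
  assumes F\<^sub>0: "F\<^sub>0 \<in> continuous_maps"
    and ab: "a \<noteq> b"
    and closed: "\<And>n. closed (C n)"
    and C01: "\<And>n. C n \<subseteq> {0..<1}"
begin

text \<open>
  The coordinates from \<open>h\<close> on are arranged in blocks: the pair \<open>(n, k)\<close> stands for the
  \<open>k\<close>-th block of the \<open>n\<close>-th chain, which has infinitely many coordinates, of which
  only \<open>block_size k\<close> are ever read.
\<close>

definition position :: "nat \<Rightarrow> nat \<times> nat" where
  "position i = prod_decode (fst (prod_decode (i - h)))"

definition block :: "nat \<Rightarrow> nat \<Rightarrow> nat set" where
  "block n k = (\<lambda>j. h + prod_encode (prod_encode (n, k), j)) ` {..<block_size k}"

text \<open>
  A block filled with the letter \<open>a\<close> shows it with frequency about \<open>noise \<epsilon> a a\<close> after a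
  perturbation of size \<open>\<epsilon>\<close>, so the same test recovers the stored letter and detects
  whether \<open>\<epsilon>\<close> is close to \<open>C n\<close>.
\<close>

definition reads :: "nat \<Rightarrow> nat \<Rightarrow> (nat \<Rightarrow> 'a) \<Rightarrow> bool" where
  "reads n k x \<longleftrightarrow> (\<exists>e\<in>C n.
     \<bar>real (card {i\<in>block n k. x i = a}) / real (block_size k) - noise e a a\<bar> < 1 / real (k + 1))"

text \<open>Every coordinate of position \<open>(n, k)\<close> receives the letter read from block
  \<open>Suc k\<close>, whether or not it lies in the part of its block that is read in
  turn.\<close>

definition chain_map :: "(nat \<Rightarrow> 'a) \<Rightarrow> nat \<Rightarrow> 'a" where
  "chain_map x i = (if i < h then F\<^sub>0 x i
     else case position i of (n, k) \<Rightarrow> if reads n (Suc k) x then a else b)"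

lemma finite_block: "finite (block n k)"
  by (simp add: block_def)

lemma card_block: "card (block n k) = block_size k"
  unfolding block_def by (subst card_image) (auto simp: inj_on_def prod_encode_eq)

lemma block_nonempty: "block n k \<noteq> {}"
  using block_size_pos[of k] by (auto simp: block_def)

lemma block_ge: "i \<in> block n k \<Longrightarrow> h \<le> i"
  by (auto simp: block_def)

lemma position_block: "i \<in> block n k \<Longrightarrow> position i = (n, k)"
  by (auto simp: block_def position_def)

lemma chain_map_ge: "h \<le> i \<Longrightarrow> position i = (n, k) \<Longrightarrow> chain_map x i = (if reads n (Suc k) x then a else b)"
  by (simp add: chain_map_def)

lemma chain_map_block: "i \<in> block n k \<Longrightarrow> chain_map x i = (if reads n (Suc k) x then a else b)"
  by (simp add: chain_map_ge block_ge position_block)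

lemma reads_depends: "depends_on (block n k) (reads n k)"
proof (rule depends_onI)
  fix x y :: "nat \<Rightarrow> 'a" assume "\<And>i. i \<in> block n k \<Longrightarrow> x i = y i"
  then have "{i\<in>block n k. x i = a} = {i\<in>block n k. y i = a}" by auto
  then show "reads n k x = reads n k y" by (simp add: reads_def)
qed

lemma chain_map_continuous: "chain_map \<in> continuous_maps"
proof (rule continuous_mapsI)
  fix i
  obtain n k where nk: "position i = (n, k)" by fastforce
  show "\<exists>S. finite S \<and> depends_on S (\<lambda>x. chain_map x i)"
  proof (cases "i < h")
    case True
    then show ?thesis
      using continuous_map_local[OF F\<^sub>0, of "{i}"] by (auto simp: chain_map_def)
  next
    case False
    then have "(\<lambda>x. chain_map x i) = (\<lambda>x. if reads n (Suc k) x then a else b)"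
      using nk by (simp add: chain_map_def)
    then show ?thesis
      using finite_block[of n "Suc k"] depends_on_comp[OF reads_depends, where h = "\<lambda>r. if r then a else b"] by auto
  qed
qed

section \<open>Reliability of the block test\<close>

lemma block_deviation:
  assumes G: "perturbed_map G \<epsilon>" and r: "\<And>i. i \<in> block n k \<Longrightarrow> G x i = r"
    and B: "\<And>y. B y \<Longrightarrow> 1 / real (k + 1) \<le> \<bar>real (card {i\<in>block n k. y i = a}) / real (block_size k) - noise \<epsilon> r a\<bar>"
    and d: "depends_on (block n k) B"
  shows "transfer G \<epsilon> (\<lambda>y. of_bool (B y)) x \<le> 1 / 2 ^ k"
proof -
  have "transfer G \<epsilon> (\<lambda>y. of_bool (B y)) x \<le> 1 / (real (card (block n k)) * (1 / real (k + 1))\<^sup>2)"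
    by (rule perturbed_map.frequency_deviation[OF G finite_block block_nonempty r _ _ d])
       (use B in \<open>auto simp: card_block\<close>)
  also have "\<dots> = 1 / 2 ^ k"
    by (simp add: card_block block_size_def power_divide del: of_nat_Suc of_nat_add)
  finally show ?thesis .
qed

text \<open>The witness \<open>e = \<epsilon>\<close> passes the test unless the frequency of
  \<open>a\<close> deviates from its own mean.\<close>

lemma reads_if_close:
  assumes G: "perturbed_map G \<epsilon>" and r: "\<And>i. i \<in> block n k \<Longrightarrow> G x i = a" and "\<epsilon> \<in> C n"
  shows "transfer G \<epsilon> (\<lambda>y. of_bool (\<not> reads n k y)) x \<le> 1 / 2 ^ k"
  by (rule block_deviation[OF G r]) (use \<open>\<epsilon> \<in> C n\<close> depends_on_comp[OF reads_depends, where h = Not] in \<open>force simp: reads_def not_less\<close>)+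

text \<open>A gap of twice the tolerance of the test leaves a deviation of at least one tolerance
  from the true mean.\<close>

lemma not_reads_if_far:
  assumes G: "perturbed_map G \<epsilon>" and r: "\<And>i. i \<in> block n k \<Longrightarrow> G x i = r"
    and far: "\<And>e. e \<in> C n \<Longrightarrow> 2 / real (k + 1) \<le> \<bar>noise e a a - noise \<epsilon> r a\<bar>"
  shows "transfer G \<epsilon> (\<lambda>y. of_bool (reads n k y)) x \<le> 1 / 2 ^ k"
proof (rule block_deviation[OF G r _ reads_depends])
  fix y assume "reads n k y"
  then obtain e where e: "e \<in> C n" "\<bar>real (card {i\<in>block n k. y i = a}) / real (block_size k) - noise e a a\<bar> < 1 / real (k + 1)"
    by (auto simp: reads_def)
  have "2 / real (k + 1) = 1 / real (k + 1) + 1 / real (k + 1)" by simp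
  then show "1 / real (k + 1) \<le> \<bar>real (card {i\<in>block n k. y i = a}) / real (block_size k) - noise \<epsilon> r a\<bar>"
    using far[OF e(1)] e(2) by linarith
qed

lemma one_less_card: "1 < real CARD('a)"
proof -
  have "card {a, b} \<le> CARD('a)" by (intro card_mono) auto
  then show ?thesis using ab by simp
qed

lemma eventually_less_gap:
  assumes "\<gamma> > 0"
  shows "\<exists>k\<^sub>0. \<forall>k\<ge>k\<^sub>0. 2 / real (k + 1) \<le> \<gamma>"
proof -
  obtain k\<^sub>0 :: nat where k0: "2 / \<gamma> < real k\<^sub>0" using reals_Archimedean2 by blast
  have "2 / real (k + 1) \<le> \<gamma>" if "k \<ge> k\<^sub>0" for k
  proof -
    have "2 / \<gamma> < real (k + 1)" using k0 that by linarith
    then show ?thesis using assms by (simp add: field_simps)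
  qed
  then show ?thesis by blast
qed

text \<open>Among \<open>b\<close>'s the letter \<open>a\<close> has frequency at most
  \<open>1 / CARD('a)\<close>. Among \<open>a\<close>'s its frequency exceeds this by
  \<open>(1 - e) * (1 - 1 / CARD('a))\<close>, which is bounded below because the compact set
  \<open>C n\<close> has a maximum less than 1.\<close>

lemma gap_from_b:
  assumes "\<epsilon> \<in> {0..1}"
  shows "\<exists>k\<^sub>0. \<forall>k\<ge>k\<^sub>0. \<forall>e\<in>C n. 2 / real (k + 1) \<le> \<bar>noise e a a - noise \<epsilon> b a\<bar>"
proof (cases "C n = {}")
  case False
  have "C n \<subseteq> {0..1}" using C01[of n] by (rule order_trans) auto
  then have "bounded (C n)" by (rule bounded_subset[OF bounded_closed_interval])
  then have "compact (C n)" using closed[of n] by (simp add: compact_eq_bounded_closed)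
  then obtain s where s: "s \<in> C n" "\<And>e. e \<in> C n \<Longrightarrow> e \<le> s"
    using compact_attains_sup[of "C n"] False by blast
  let ?q = "real CARD('a)"
  let ?g = "(1 - s) * (1 - 1 / ?q)"
  have s1: "s < 1" using s(1) C01 by fastforce
  then have "?g > 0" using one_less_card by simp
  then obtain k\<^sub>0 where k0: "\<And>k. k \<ge> k\<^sub>0 \<Longrightarrow> 2 / real (k + 1) \<le> ?g"
    using eventually_less_gap by blast
  have "?g \<le> \<bar>noise e a a - noise \<epsilon> b a\<bar>" if "e \<in> C n" for e
  proof -
    have "?g \<le> (1 - e) * (1 - 1 / ?q)"
      using s(2)[OF that] one_less_card by (intro mult_right_mono) auto
    also have "\<dots> = (1 - e + e / ?q) - 1 / ?q" by (simp add: algebra_simps diff_divide_distrib)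
    also have "\<dots> \<le> (1 - e + e / ?q) - \<epsilon> / ?q"
      using assms by (intro diff_left_mono divide_right_mono) auto
    also have "\<dots> = noise e a a - noise \<epsilon> b a"
      using ab by (simp add: noise_def)
    finally show ?thesis by linarith
  qed
  then show ?thesis using k0 by (meson order_trans)
qed simp

text \<open>\<open>noise e a a\<close> is affine in \<open>e\<close> with nonzero slope, so the gap
  is proportional to the positive distance from \<open>\<epsilon>\<close> to the closed set
  \<open>C n\<close>.\<close>

lemma gap_from_a:
  assumes "\<epsilon> \<notin> C n"
  shows "\<exists>k\<^sub>0. \<forall>k\<ge>k\<^sub>0. \<forall>e\<in>C n. 2 / real (k + 1) \<le> \<bar>noise e a a - noise \<epsilon> a a\<bar>"
proof -
  let ?q = "real CARD('a)"
  obtain d where d: "d > 0" "\<And>e. e \<in> C n \<Longrightarrow> d \<le> dist \<epsilon> e"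
    using separate_point_closed[OF closed assms] by blast
  have p: "1 - 1 / ?q > 0" using one_less_card by simp
  then obtain k\<^sub>0 where k0: "\<And>k. k \<ge> k\<^sub>0 \<Longrightarrow> 2 / real (k + 1) \<le> (1 - 1 / ?q) * d"
    using eventually_less_gap[of "(1 - 1 / ?q) * d"] d(1) by (metis mult_pos_pos)
  have "(1 - 1 / ?q) * d \<le> \<bar>noise e a a - noise \<epsilon> a a\<bar>" if "e \<in> C n" for e
  proof -
    have "noise e a a - noise \<epsilon> a a = (1 - 1 / ?q) * (\<epsilon> - e)"
      by (simp add: noise_def algebra_simps diff_divide_distrib)
    then have "\<bar>noise e a a - noise \<epsilon> a a\<bar> = (1 - 1 / ?q) * dist \<epsilon> e"
      using p by (simp add: abs_mult dist_real_def)
    then show ?thesis using d(2)[OF that] p by simp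
  qed
  then show ?thesis using k0 by (meson order_trans)
qed

end

locale perturbed_chain = chain_system +
  fixes \<epsilon> :: real
  assumes eps: "\<epsilon> \<in> {0..1}"

sublocale perturbed_chain \<subseteq> perturbed_map chain_map \<epsilon>
  by unfold_locales (rule chain_map_continuous eps)+

context perturbed_chain
begin

lemma perturbed: "perturbed_map chain_map \<epsilon>"
  by unfold_locales

text \<open>Noisy constant maps act as random sources that show the existence of blocks with a
  prescribed reading.\<close>

lemma perturbed_constant: "perturbed_map (\<lambda>x i. c) \<epsilon>"
  by unfold_locales (use eps in \<open>auto intro!: continuous_mapsI simp: depends_on_const\<close>)

lemma transmission_depends: "depends_on (block n k) (\<lambda>y. of_bool (reads n k y) :: real)"
  by (rule depends_on_comp[OF reads_depends])

lemma transmission_bounds: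
  assumes "\<epsilon> \<in> C n" "\<And>e. e \<in> C n \<Longrightarrow> 2 / real (k + 1) \<le> \<bar>noise e a a - noise \<epsilon> b a\<bar>"
  shows "of_bool (reads n (Suc k) x) - 1 / 2 ^ k \<le> P (\<lambda>y. of_bool (reads n k y)) x"
    and "P (\<lambda>y. of_bool (reads n k y)) x \<le> of_bool (reads n (Suc k) x) + 1 / 2 ^ k"
proof -
  have P01: "0 \<le> P (\<lambda>y. of_bool (reads n k y)) x" "P (\<lambda>y. of_bool (reads n k y)) x \<le> 1"
    by (rule P_ge[OF finite_block transmission_depends] P_le[OF finite_block transmission_depends]; simp)+
  have pos: "0 < (1 / 2 ^ k :: real)" by simp
  have "P (\<lambda>y. of_bool (\<not> reads n k y)) x = 1 - P (\<lambda>y. of_bool (reads n k y)) x"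
    using P_diff[OF finite.emptyI depends_on_const finite_block transmission_depends, of 1 n k]
    by (simp add: P_const of_bool_not_iff)
  moreover have "P (\<lambda>y. of_bool (\<not> reads n k y)) x \<le> 1 / 2 ^ k" if "reads n (Suc k) x"
    by (rule reads_if_close[OF perturbed _ assms(1)]) (use that in \<open>simp add: chain_map_block\<close>)
  ultimately show "of_bool (reads n (Suc k) x) - 1 / 2 ^ k \<le> P (\<lambda>y. of_bool (reads n k y)) x"
    using P01 pos unfolding of_bool_def by (smt (verit))
  have "P (\<lambda>y. of_bool (reads n k y)) x \<le> 1 / 2 ^ k" if "\<not> reads n (Suc k) x"
    by (rule not_reads_if_far[OF perturbed _ assms(2)]) (use that in \<open>simp add: chain_map_block\<close>)
  then show "P (\<lambda>y. of_bool (reads n k y)) x \<le> of_bool (reads n (Suc k) x) + 1 / 2 ^ k"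
    using P01 pos unfolding of_bool_def by (smt (verit))
qed

text \<open>Different blocks of one chain are disjoint, so their contents can be chosen
  independently.\<close>

lemma assemble_blocks: "\<exists>x. \<forall>k. reads n k x = reads n k (y k)"
proof (intro exI allI)
  show "reads n k (\<lambda>i. y (snd (position i)) i) = reads n k (y k)" for k
    by (rule depends_onD[OF reads_depends]) (simp add: position_block)
qed

text \<open>The bit at level \<open>k + t\<close> travels down to level \<open>k\<close>; the errors
  \<open>1 / 2 ^ j\<close> for \<open>j \<ge> k\<close> sum to at most
  \<open>2 / 2 ^ k\<close>.\<close>

lemma iterated_transmission_bounds:
  assumes \<epsilon>: "\<epsilon> \<in> C n"
    and k\<^sub>0: "\<And>k e. k \<ge> k\<^sub>0 \<Longrightarrow> e \<in> C n \<Longrightarrow> 2 / real (k + 1) \<le> \<bar>noise e a a - noise \<epsilon> b a\<bar>"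
    and "k \<ge> k\<^sub>0"
  shows "of_bool (reads n (k + t) x) - 2 / 2 ^ k \<le> (P ^^ t) (\<lambda>y. of_bool (reads n k y)) x \<and>
    (P ^^ t) (\<lambda>y. of_bool (reads n k y)) x \<le> of_bool (reads n (k + t) x) + 2 / 2 ^ k"
  using \<open>k \<ge> k\<^sub>0\<close>
proof (induction t arbitrary: k)
  case (Suc t)
  let ?f = "\<lambda>k y. of_bool (reads n k y) :: real"
  note f = finite_block transmission_depends
  have shift: "2 / 2 ^ Suc k + 1 / 2 ^ k = (2 / 2 ^ k :: real)" by simp
  have step: "?f (Suc k) y + (- (1 / 2 ^ k)) \<le> P (?f k) y" "P (?f k) y \<le> ?f (Suc k) y + 1 / 2 ^ k" for y
    using transmission_bounds[OF \<epsilon> k\<^sub>0[OF Suc.prems], of y] by auto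
  have c: "depends_on (block n (Suc k)) (\<lambda>y. ?f (Suc k) y + c)" for c
    by (rule depends_on_comp[OF transmission_depends])
  obtain m where m: "depends_on {..<m} (P (?f k))" using P_local[OF f] by blast
  have add: "(P ^^ t) (\<lambda>y. ?f (Suc k) y + c) = (\<lambda>y. (P ^^ t) (?f (Suc k)) y + c)" for c
    using Pn_add[OF f finite.emptyI depends_on_const, of t n "Suc k" c] by (simp add: Pn_const)
  have "(P ^^ t) (\<lambda>y. ?f (Suc k) y + (- (1 / 2 ^ k))) x \<le> (P ^^ t) (P (?f k)) x"
    by (rule Pn_mono[OF finite_block c finite_lessThan m step(1)])
  moreover have "(P ^^ t) (P (?f k)) x \<le> (P ^^ t) (\<lambda>y. ?f (Suc k) y + 1 / 2 ^ k) x"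
    by (rule Pn_mono[OF finite_lessThan m finite_block c step(2)])
  moreover have "?f (Suc k + t) x - 2 / 2 ^ Suc k \<le> (P ^^ t) (?f (Suc k)) x"
    "(P ^^ t) (?f (Suc k)) x \<le> ?f (Suc k + t) x + 2 / 2 ^ Suc k"
    using Suc.IH[of "Suc k"] Suc.prems by auto
  ultimately show ?case
    using shift unfolding add funpow_Suc_right o_apply add_Suc add_Suc_right by linarith
qed simp

lemma not_unique:
  assumes \<epsilon>: "\<epsilon> \<in> C n"
  shows "\<epsilon> \<notin> Uni chain_map"
proof -
  obtain k1 where k1: "\<And>k e. k \<ge> k1 \<Longrightarrow> e \<in> C n \<Longrightarrow> 2 / real (k + 1) \<le> \<bar>noise e a a - noise \<epsilon> b a\<bar>"
    using gap_from_b[OF eps, of n] by blast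
  \<comment> \<open>From 3 on the total error \<open>2 / 2 ^ k\<close> is at most 1/4, which keeps
    the two orbits below 1/4 and above 3/4.\<close>
  define k where "k = max k1 3"
  let ?f = "\<lambda>y. of_bool (reads n k y) :: real"
  have "(2::real) ^ 3 \<le> 2 ^ k" by (intro power_increasing) (auto simp: k_def)
  then have small: "2 / 2 ^ k \<le> (1 / 4 :: real)" by (simp add: field_simps)
  have one: "(1 / 2 ^ j :: real) < 1" if "j \<ge> k" for j
  proof -
    have "0 < j" using that by (simp add: k_def)
    then show ?thesis by simp
  qed
  \<comment> \<open>Probabilistic method: a noisy block of \<open>a\<close>'s fails the test with
    probability less than 1, so some configuration passes it.\<close>
  have "\<exists>y. reads n j y" if "j \<ge> k" for j
  proof (rule ccontr)
    assume "\<nexists>y. reads n j y"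
    then have "transfer (\<lambda>x i. a) \<epsilon> (\<lambda>y. of_bool (\<not> reads n j y)) undefined = 1"
      using perturbed_map.P_const[OF perturbed_constant, of a 1] by simp
    then show False
      using reads_if_close[OF perturbed_constant refl \<epsilon>, of j undefined] one[OF that] by simp
  qed
  then obtain y where y: "\<And>j. j \<ge> k \<Longrightarrow> reads n j (y j)" by metis
  then obtain x\<^sub>a where xa: "\<And>j. j \<ge> k \<Longrightarrow> reads n j x\<^sub>a" using assemble_blocks[of n y] by blast
  have "\<exists>y. \<not> reads n j y" if "j \<ge> k" for j
  proof (rule ccontr)
    assume "\<nexists>y. \<not> reads n j y"
    then have "transfer (\<lambda>x i. b) \<epsilon> (\<lambda>y. of_bool (reads n j y)) undefined = 1"
      using perturbed_map.P_const[OF perturbed_constant, of b 1] by simp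
    moreover have "transfer (\<lambda>x i. b) \<epsilon> (\<lambda>y. of_bool (reads n j y)) undefined \<le> 1 / 2 ^ j"
      by (rule not_reads_if_far[OF perturbed_constant refl k1]) (use that in \<open>auto simp: k_def\<close>)
    ultimately show False using one[OF that] by simp
  qed
  then obtain z where z: "\<And>j. j \<ge> k \<Longrightarrow> \<not> reads n j (z j)" by metis
  then obtain x\<^sub>b where xb: "\<And>j. j \<ge> k \<Longrightarrow> \<not> reads n j x\<^sub>b" using assemble_blocks[of n z] by blast
  have bounds: "of_bool (reads n (k + t) x) - 2 / 2 ^ k \<le> (P ^^ t) ?f x"
    "(P ^^ t) ?f x \<le> of_bool (reads n (k + t) x) + 2 / 2 ^ k" for t x
    using iterated_transmission_bounds[OF \<epsilon> k1, where k = k and t = t and x = x] by (auto simp: k_def)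
  show ?thesis
  proof (rule not_uniquely_ergodic[OF finite_block transmission_depends])
    show "of_bool (reads n k x) \<in> {0..1::real}" for x by simp
    show "(P ^^ t) ?f x\<^sub>b \<le> 1 / 4" for t
    proof -
      have "(of_bool (reads n (k + t) x\<^sub>b) :: real) = 0" using xb[of "k + t"] by simp
      then show ?thesis using bounds(2)[of t "x\<^sub>b"] small by linarith
    qed
    show "3 / 4 \<le> (P ^^ t) ?f x\<^sub>a" for t
    proof -
      have "(of_bool (reads n (k + t) x\<^sub>a) :: real) = 1" using xa[of "k + t"] by simp
      then show ?thesis using bounds(1)[of t "x\<^sub>a"] small by linarith
    qed
  qed simp
qed

text \<open>After \<open>t\<close> steps the observable depends only on the readings of finitely
  many blocks at depth growing with \<open>t\<close>. Such blocks almost surely read as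
  \<open>b\<close> whatever they were filled with, so one more step makes the function nearly
  constant.\<close>

lemma tail_forgets:
  assumes \<epsilon>: "\<And>n. \<epsilon> \<notin> C n"
    and S: "finite S" "S \<inter> {..<h} = {}" and f: "depends_on S f" "\<And>x. f x \<in> {0..1}"
  shows "forgets f"
  unfolding forgets_def
proof (intro allI impI)
  fix \<eta> :: real assume "\<eta> > 0"
  define B where "B = position ` S"
  have B: "finite B" using S(1) by (simp add: B_def)
  have blocks: "finite (\<Union>(n, k)\<in>B. block n (k + t))" for t
    using B finite_block by auto
  \<comment> \<open>Coordinates from \<open>h\<close> on take their values from blocks, which never
    meet the head; each step moves all readings one level up their chains.\<close>
  have Pnf: "(P ^^ Suc t) f x = (P ^^ Suc t) f y"
    if "\<And>n k. (n, k) \<in> B \<Longrightarrow> reads n (k + Suc t) x = reads n (k + Suc t) y" for t x y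
    using that
  proof (induction t arbitrary: x y)
    case 0
    have "chain_map x i = chain_map y i" if "i \<in> S" for i
    proof -
      obtain n k where nk: "position i = (n, k)" by fastforce
      then have "(n, k) \<in> B" using that unfolding B_def by (metis imageI)
      moreover have "h \<le> i" using that S(2) by (metis disjoint_iff lessThan_iff not_less)
      ultimately show ?thesis using 0 nk by (simp add: chain_map_ge)
    qed
    from P_cong[OF S(1) f(1) this] show ?case by simp
  next
    case (Suc t)
    have "depends_on (\<Union>(n, k)\<in>B. block n (k + Suc t)) ((P ^^ Suc t) f)"
    proof (rule depends_onI)
      fix x y :: "nat \<Rightarrow> 'a"
      assume xy: "\<And>i. i \<in> (\<Union>(n, k)\<in>B. block n (k + Suc t)) \<Longrightarrow> x i = y i"
      show "(P ^^ Suc t) f x = (P ^^ Suc t) f y"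
        by (rule Suc.IH, rule depends_onD[OF reads_depends], rule xy) blast
    qed
    moreover have "chain_map x i = chain_map y i" if "i \<in> (\<Union>(n, k)\<in>B. block n (k + Suc t))" for i
      using that Suc.prems by (auto simp: chain_map_block)
    ultimately have "P ((P ^^ Suc t) f) x = P ((P ^^ Suc t) f) y"
      by (rule P_cong[OF blocks])
    then show ?case by simp
  qed
  have "\<exists>k\<^sub>0. \<forall>k\<ge>k\<^sub>0. \<forall>x. P (\<lambda>y. of_bool (reads n k y)) x \<le> 1 / 2 ^ k" for n
  proof -
    obtain k1 where k1: "\<And>k e. k \<ge> k1 \<Longrightarrow> e \<in> C n \<Longrightarrow> 2 / real (k + 1) \<le> \<bar>noise e a a - noise \<epsilon> b a\<bar>"
      using gap_from_b[OF eps, of n] by blast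
    obtain k2 where k2: "\<And>k e. k \<ge> k2 \<Longrightarrow> e \<in> C n \<Longrightarrow> 2 / real (k + 1) \<le> \<bar>noise e a a - noise \<epsilon> a a\<bar>"
      using gap_from_a[OF \<epsilon>, of n] by blast
    have "P (\<lambda>y. of_bool (reads n k y)) x \<le> 1 / 2 ^ k" if "k \<ge> max k1 k2" for k x
      by (rule not_reads_if_far[OF perturbed, of n k x "if reads n (Suc k) x then a else b"])
         (use that k1 k2 in \<open>auto simp: chain_map_block\<close>)
    then show ?thesis by blast
  qed
  then obtain k\<^sub>0 where k0: "\<And>n k x. k \<ge> k\<^sub>0 n \<Longrightarrow> P (\<lambda>y. of_bool (reads n k y)) x \<le> 1 / 2 ^ k"
    by metis
  define N where "N = real (card B)"
  \<comment> \<open>Chosen so that the union bound over \<open>B\<close> costs at most \<eta>/2; the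
    summand 1 keeps the denominator positive when \<open>B\<close> is empty.\<close>
  obtain t1 where t1: "(1 / 2) ^ t1 < \<eta> / (2 * N + 1)"
    using real_arch_pow_inv[of "\<eta> / (2 * N + 1)" "1 / 2"] \<open>\<eta> > 0\<close> by (auto simp: N_def)
  \<comment> \<open>Also beyond the thresholds of the finitely many chains that occur in
    \<open>B\<close>; inserting 0 keeps the maximum defined.\<close>
  define t where "t = max t1 (Max (insert 0 (k\<^sub>0 ` fst ` B)))"
  have t: "t1 \<le> t" "k\<^sub>0 n \<le> k + Suc t" if "(n, k) \<in> B" for n k
  proof -
    have "k\<^sub>0 n \<le> Max (insert 0 (k\<^sub>0 ` fst ` B))"
      using B that by (intro Max_ge) force+
    then show "k\<^sub>0 n \<le> k + Suc t" by (simp add: t_def)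
  qed (simp add: t_def)
  let ?g = "(P ^^ Suc t) f"
  let ?S = "\<Union>(n, k)\<in>B. block n (k + Suc t)"
  \<comment> \<open>The number of relevant blocks that read as \<open>a\<close>. It dominates the
    deviation of \<open>?g\<close> from a constant and has small expectation from every starting
    point.\<close>
  define Z where "Z y = (\<Sum>(n, k)\<in>B. of_bool (reads n (k + Suc t) y) :: real)" for y
  have g: "depends_on ?S ?g"
    by (rule depends_onI, rule Pnf, rule depends_onD[OF reads_depends]) blast
  have g01: "?g y \<in> {0..1}" for y
    using Pn_ge[OF S(1) f(1), of 0 "Suc t" y] Pn_le[OF S(1) f(1), of 1 "Suc t" y] f(2)
    by (simp del: funpow.simps)
  have Zd: "depends_on ?S Z"
    unfolding Z_def by (intro depends_on_sum) (auto intro!: depends_on_mono[OF transmission_depends])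
  have PZ: "P Z x \<le> N * (1 / 2) ^ t1" for x
  proof -
    have "P Z x = (\<Sum>p\<in>B. P (\<lambda>y. case p of (n, k) \<Rightarrow> of_bool (reads n (k + Suc t) y)) x)"
      unfolding Z_def by (subst P_sum[of B "\<lambda>(n, k). block n (k + Suc t)"])
        (auto simp: finite_block transmission_depends)
    also have "\<dots> \<le> (\<Sum>p\<in>B. (1 / 2) ^ t1)"
    proof (rule sum_mono, clarify)
      fix n k assume nk: "(n, k) \<in> B"
      have "P (\<lambda>y. of_bool (reads n (k + Suc t) y)) x \<le> 1 / 2 ^ (k + Suc t)"
        by (rule k0) (use t(2)[OF nk] in simp)
      also have "\<dots> \<le> 1 / 2 ^ t1"
        using t(1)[OF nk] by (intro divide_left_mono power_increasing) auto
      finally show "P (\<lambda>y. of_bool (reads n (k + Suc t) y)) x \<le> (1 / 2) ^ t1"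
        by (simp add: power_one_over)
    qed
    finally show ?thesis by (simp add: N_def)
  qed
  \<comment> \<open>The constant is the value of \<open>?g\<close> when no block reads as
    \<open>a\<close>. If no such configuration exists, \<open>Z\<close> is at least 1 everywhere and
    0 will do.\<close>
  obtain u where u: "\<And>y. \<bar>?g y - u\<bar> \<le> Z y"
  proof -
    define E where "E y \<longleftrightarrow> (\<forall>(n, k)\<in>B. \<not> reads n (k + Suc t) y)" for y
    have nE: "1 \<le> Z y" if nEy: "\<not> E y" for y
    proof -
      obtain n k where p: "(n, k) \<in> B" and "reads n (k + Suc t) y"
        using nEy by (auto simp: E_def)
      then have "(1::real) \<le> of_bool (reads n (k + Suc t) y)" by simp
      also have "\<dots> \<le> Z y"
        unfolding Z_def using B p
          member_le_sum[of "(n, k)" B "\<lambda>(n, k). of_bool (reads n (k + Suc t) y) :: real"] by auto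
      finally show ?thesis .
    qed
    have Z0: "0 \<le> Z y" for y
      unfolding Z_def by (intro sum_nonneg) auto
    show thesis
    proof (cases "\<exists>y. E y")
      case True
      then obtain y0 where y0: "E y0" ..
      have "\<bar>?g y - ?g y0\<bar> \<le> Z y" for y
      proof (cases "E y")
        case True
        have "?g y = ?g y0"
          by (rule Pnf) (use True y0 in \<open>auto simp: E_def\<close>)
        then show ?thesis using Z0[of y] by linarith
      next
        case False
        then show ?thesis using nE[of y] g01[of y] g01[of y0] unfolding atLeastAtMost_iff by linarith
      qed
      then show thesis by (rule that)
    next
      case False
      have "\<bar>?g y - 0\<bar> \<le> Z y" for y
        using False nE[of y] g01[of y] unfolding atLeastAtMost_iff by auto
      then show thesis by (rule that)
    qed
  qed
  have Zu: "depends_on ?S (\<lambda>y. u + Z y)" "depends_on ?S (\<lambda>y. u - Z y)"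
    by (rule depends_on_comp[OF Zd])+
  have up: "P ?g x \<le> u + P Z x" for x
  proof -
    have "P ?g x \<le> P (\<lambda>y. u + Z y) x"
      by (rule P_mono[OF blocks g blocks Zu(1)]) (use u in \<open>smt (verit)\<close>)
    then show ?thesis
      by (simp only: P_add[OF finite.emptyI depends_on_const blocks Zd] P_const)
  qed
  have lo: "u - P Z x \<le> P ?g x" for x
  proof -
    have "P (\<lambda>y. u - Z y) x \<le> P ?g x"
      by (rule P_mono[OF blocks Zu(2) blocks g]) (use u in \<open>smt (verit)\<close>)
    then show ?thesis
      by (simp only: P_diff[OF finite.emptyI depends_on_const blocks Zd] P_const)
  qed
  have "N * (1 / 2) ^ t1 * 2 \<le> \<eta>"
  proof -
    have N: "0 \<le> N" by (simp add: N_def)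
    have "(1 / 2) ^ t1 * (2 * N + 1) < \<eta>"
      using t1 N by (simp add: pos_less_divide_eq)
    moreover have "(1 / 2) ^ t1 * (2 * N + 1) = N * (1 / 2) ^ t1 * 2 + (1 / 2) ^ t1"
      by (simp add: algebra_simps)
    moreover have "(0::real) \<le> (1 / 2) ^ t1" by simp
    ultimately show ?thesis by linarith
  qed
  then have "(P ^^ Suc (Suc t)) f x - (P ^^ Suc (Suc t)) f y \<le> \<eta>" for x y
    using up[of x] lo[of y] PZ[of x] PZ[of y] unfolding funpow.simps(2)[of "Suc t"] o_apply by linarith
  then show "\<exists>t. \<forall>x y. (P ^^ t) f x - (P ^^ t) f y \<le> \<eta>" by blast
qed

lemma unique:
  assumes "\<And>n. \<epsilon> \<notin> C n" "\<epsilon> > 0 \<or> h = 0"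
  shows "\<epsilon> \<in> Uni chain_map"
  by (rule uniquely_ergodic, rule forgets_of_tail[OF tail_forgets assms(2)]) (use assms(1) in auto)

end

text \<open>The refreshing argument for a nonempty head needs positive noise; the hypothesis places
  \<open>\<epsilon> = 0\<close> on the non-unique side in that case.\<close>

lemma (in chain_system) Uni_chain_map:
  assumes "h = 0 \<or> 0 \<in> (\<Union>n. C n)"
  shows "Uni chain_map = {0..1} - (\<Union>n. C n)"
proof -
  have "\<epsilon> \<in> Uni chain_map \<longleftrightarrow> \<epsilon> \<notin> (\<Union>n. C n)" if "\<epsilon> \<in> {0..1}" for \<epsilon>
  proof -
    interpret perturbed_chain F\<^sub>0 h a b C \<epsilon>
      using that by unfold_locales
    show ?thesis
    proof (cases "\<epsilon> \<in> (\<Union>n. C n)")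
      case True
      then show ?thesis using not_unique by blast
    next
      case False
      then have "\<epsilon> > 0 \<or> h = 0" using assms that by (cases "\<epsilon> = 0") auto
      then show ?thesis using False unique by blast
    qed
  qed
  moreover have "Uni chain_map \<subseteq> {0..1}" by (auto simp: Uni_def)
  ultimately show ?thesis by blast
qed

section \<open>Density and genericity\<close>

lemma agree_if_map_dist_less:
  assumes "map_dist F F' < 1 / 2 ^ n" "i \<le> n"
  shows "F x i = F' x i"
proof -
  have "config_dist (F x) (F' x) < 1 / 2 ^ n"
    using config_dist_le_map_dist[of F x F'] assms(1) by linarith
  then show ?thesis
    using assms(2) by (simp add: config_dist_less_iff)
qed

lemma map_dist_le_if_agree:
  assumes "\<And>x i. i \<le> n \<Longrightarrow> F x i = F' x i"
  shows "map_dist F F' \<le> 1 / 2 ^ n"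
  unfolding map_dist_def
proof (rule cSUP_least)
  show "config_dist (F x) (F' x) \<le> 1 / 2 ^ n" for x
    using assms config_dist_less_iff[of "F x" "F' x" n] by (auto intro: less_imp_le)
qed simp

lemma openin_continuous_mapsI:
  fixes U :: "((nat \<Rightarrow> 'a::{finite, discrete_topology}) \<Rightarrow> nat \<Rightarrow> 'a) set"
  assumes "U \<subseteq> continuous_maps"
    and nbhd: "\<And>F. F \<in> U \<Longrightarrow> \<exists>n. \<forall>F'\<in>continuous_maps. (\<forall>x. \<forall>i\<le>n. F' x i = F x i) \<longrightarrow> F' \<in> U"
  shows "openin continuous_maps_topology U"
proof -
  interpret M: Metric_space "continuous_maps :: ((nat \<Rightarrow> 'a) \<Rightarrow> nat \<Rightarrow> 'a) set" map_dist
    by (rule Metric_space_maps)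
  show ?thesis
    unfolding continuous_maps_topology_def M.openin_mtopology
  proof (intro conjI assms(1) allI impI)
    fix F assume "F \<in> U"
    then obtain n where n: "\<And>F'. F' \<in> continuous_maps \<Longrightarrow> (\<And>x i. i \<le> n \<Longrightarrow> F' x i = F x i) \<Longrightarrow> F' \<in> U"
      using nbhd[OF \<open>F \<in> U\<close>] by blast
    have "M.mball F (1 / 2 ^ n) \<subseteq> U"
    proof
      fix F' assume "F' \<in> M.mball F (1 / 2 ^ n)"
      then show "F' \<in> U"
        using agree_if_map_dist_less[of F F' n] by (intro n) auto
    qed
    then show "\<exists>r>0. M.mball F r \<subseteq> U" by (intro exI[of _ "1 / 2 ^ n"]) simp
  qed
qed

lemma dense_in_continuous_mapsI:
  fixes S :: "((nat \<Rightarrow> 'a::{finite, discrete_topology}) \<Rightarrow> nat \<Rightarrow> 'a) set"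
  assumes "S \<subseteq> continuous_maps"
    and approx: "\<And>F n. F \<in> continuous_maps \<Longrightarrow> \<exists>F'\<in>S. \<forall>x. \<forall>i<n. F' x i = F x i"
  shows "dense_in continuous_maps_topology S"
proof -
  interpret M: Metric_space "continuous_maps :: ((nat \<Rightarrow> 'a) \<Rightarrow> nat \<Rightarrow> 'a) set" map_dist
    by (rule Metric_space_maps)
  have "\<exists>F'\<in>S. F' \<in> M.mball F r" if F: "F \<in> continuous_maps" and "r > 0" for F r
  proof -
    obtain n where n: "(1 / 2) ^ n < r" using real_arch_pow_inv[of r "1 / 2"] \<open>r > 0\<close> by auto
    obtain F' where F': "F' \<in> S" "\<And>x i. i < Suc n \<Longrightarrow> F' x i = F x i" using approx[OF F] by blast
    have "map_dist F F' \<le> 1 / 2 ^ n" by (rule map_dist_le_if_agree) (simp add: F'(2))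
    then have "map_dist F F' < r" using n by (simp add: power_one_over)
    then show ?thesis using F'(1) F assms(1) by auto
  qed
  then have "continuous_maps_topology closure_of S = continuous_maps"
    unfolding continuous_maps_topology_def M.metric_closure_of by auto
  then show ?thesis
    using assms(1) by (simp add: dense_in_def)
qed

text \<open>The first step uses the first \<open>m\<close> outputs of \<open>F\<close> and yields a
  function of the first \<open>M\<close> coordinates, to which the induction applies. The resulting
  \<open>n\<close> is uniform in \<open>\<epsilon>\<close> and \<open>f\<close>.\<close>

lemma transfer_locality:
  fixes F :: "(nat \<Rightarrow> 'a::{finite, discrete_topology}) \<Rightarrow> nat \<Rightarrow> 'a"
  assumes F: "F \<in> continuous_maps"
  shows "\<exists>n. \<forall>F'\<in>continuous_maps. (\<forall>x. \<forall>i\<le>n. F' x i = F x i) \<longrightarrow>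
    (\<forall>\<epsilon>\<in>{0..1}. \<forall>f. depends_on {..<m} f \<longrightarrow> (transfer F' \<epsilon> ^^ t) f = (transfer F \<epsilon> ^^ t) f)"
proof (induction t arbitrary: m)
  case (Suc t)
  obtain M where M: "\<And>i. i < m \<Longrightarrow> depends_on {..<M} (\<lambda>x. F x i)"
    using continuous_map_local[OF F finite_lessThan, of m] by auto
  obtain n where n: "\<And>F' \<epsilon> f. F' \<in> continuous_maps \<Longrightarrow> (\<And>x i. i \<le> n \<Longrightarrow> F' x i = F x i) \<Longrightarrow> \<epsilon> \<in> {0..1} \<Longrightarrow>
      depends_on {..<M} f \<Longrightarrow> (transfer F' \<epsilon> ^^ t) f = (transfer F \<epsilon> ^^ t) f"
    using Suc.IH[of M] by blast
  show ?case
  proof (intro exI[of _ "max n m"] ballI allI impI)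
    fix F' \<epsilon> and f :: "(nat \<Rightarrow> 'a) \<Rightarrow> real"
    assume F': "F' \<in> continuous_maps" and agree: "\<forall>x. \<forall>i\<le>max n m. F' x i = F x i"
      and \<epsilon>: "\<epsilon> \<in> {0..1::real}" and f: "depends_on {..<m} f"
    interpret F: perturbed_map F \<epsilon> using F \<epsilon> by unfold_locales
    interpret F': perturbed_map F' \<epsilon> using F' \<epsilon> by unfold_locales
    have "transfer F' \<epsilon> f = transfer F \<epsilon> f"
      using agree by (auto simp: fun_eq_iff F.P_expansion[OF finite_lessThan f] F'.P_expansion[OF finite_lessThan f])
    moreover have "depends_on {..<M} (transfer F \<epsilon> f)"
      by (rule F.P_depends[OF finite_lessThan f M]) simp
    ultimately show "(transfer F' \<epsilon> ^^ Suc t) f = (transfer F \<epsilon> ^^ Suc t) f"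
      using agree n[OF F' _ \<epsilon>, of "transfer F \<epsilon> f"] by (simp only: funpow_Suc_right o_apply)
  qed
qed simp

text \<open>A single \<open>t\<close> for all \<open>f\<close> and all noise levels away from 0
  makes the condition depend on finitely many outputs of \<open>F\<close>, hence open. Membership
  for all \<open>n\<close> covers every positive noise level, tolerance and finite support.\<close>

definition mixing_maps :: "nat \<Rightarrow> ((nat \<Rightarrow> 'a::{finite, discrete_topology}) \<Rightarrow> nat \<Rightarrow> 'a) set" where
  "mixing_maps n = {F \<in> continuous_maps. \<exists>t. \<forall>\<epsilon>\<in>{1 / real (n + 1)..1}. \<forall>f. depends_on {..<n} f \<longrightarrow>
     (\<forall>x. f x \<in> {0..1}) \<longrightarrow> (\<forall>x y. (transfer F \<epsilon> ^^ t) f x - (transfer F \<epsilon> ^^ t) f y \<le> 1 / real (n + 1))}"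

definition copying_maps :: "((nat \<Rightarrow> 'a::{finite, discrete_topology}) \<Rightarrow> nat \<Rightarrow> 'a) set" where
  "copying_maps = {F \<in> continuous_maps. \<exists>j. \<forall>x. F x j = x j}"

lemma openin_mixing_maps:
  "openin continuous_maps_topology
    (mixing_maps m :: ((nat \<Rightarrow> 'a::{finite, discrete_topology}) \<Rightarrow> nat \<Rightarrow> 'a) set)"
proof (rule openin_continuous_mapsI)
  fix F :: "(nat \<Rightarrow> 'a) \<Rightarrow> nat \<Rightarrow> 'a" assume "F \<in> mixing_maps m"
  then obtain t where F: "F \<in> continuous_maps"
    and t: "\<And>\<epsilon> f x y. \<epsilon> \<in> {1 / real (m + 1)..1} \<Longrightarrow> depends_on {..<m} f \<Longrightarrow> (\<And>x. f x \<in> {0..1}) \<Longrightarrow>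
      (transfer F \<epsilon> ^^ t) f x - (transfer F \<epsilon> ^^ t) f y \<le> 1 / real (m + 1)"
    unfolding mixing_maps_def by blast
  obtain n where n: "\<And>F' \<epsilon> f. F' \<in> continuous_maps \<Longrightarrow> (\<And>x i. i \<le> n \<Longrightarrow> F' x i = F x i) \<Longrightarrow> \<epsilon> \<in> {0..1} \<Longrightarrow>
      depends_on {..<m} f \<Longrightarrow> (transfer F' \<epsilon> ^^ t) f = (transfer F \<epsilon> ^^ t) f"
    using transfer_locality[OF F, of m t] by blast
  have sub: "\<epsilon> \<in> {0..1}" if "\<epsilon> \<in> {1 / real (m + 1)..1}" for \<epsilon>
    using that order_trans[of 0 "1 / real (m + 1)" \<epsilon>] by simp
  have "F' \<in> mixing_maps m" if "F' \<in> continuous_maps" "\<And>x i. i \<le> n \<Longrightarrow> F' x i = F x i" for F'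
    unfolding mixing_maps_def
  proof (intro CollectI conjI that(1) exI[of _ t] ballI allI impI)
    fix \<epsilon> and f :: "(nat \<Rightarrow> 'a) \<Rightarrow> real" and x y
    assume "\<epsilon> \<in> {1 / real (m + 1)..1}" "depends_on {..<m} f" "\<forall>x. f x \<in> {0..1}"
    then show "(transfer F' \<epsilon> ^^ t) f x - (transfer F' \<epsilon> ^^ t) f y \<le> 1 / real (m + 1)"
      using n[OF that sub] t by simp
  qed
  then show "\<exists>n. \<forall>F'\<in>continuous_maps. (\<forall>x. \<forall>i\<le>n. F' x i = F x i) \<longrightarrow> F' \<in> mixing_maps m"
    by blast
qed (auto simp: mixing_maps_def)

lemma openin_copying_maps: "openin continuous_maps_topology copying_maps"
proof (rule openin_continuous_mapsI)
  fix F :: "(nat \<Rightarrow> 'a) \<Rightarrow> nat \<Rightarrow> 'a" assume "F \<in> copying_maps"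
  then obtain j where "\<And>x. F x j = x j" by (auto simp: copying_maps_def)
  then show "\<exists>n. \<forall>F'\<in>continuous_maps. (\<forall>x. \<forall>i\<le>n. F' x i = F x i) \<longrightarrow> F' \<in> copying_maps"
    by (intro exI[of _ j]) (auto simp: copying_maps_def intro!: exI[of _ j])
qed (auto simp: copying_maps_def)

text \<open>Without noise a copied coordinate is conserved, so its indicator is fixed by
  \<open>P\<close> and separates the constant configurations \<open>a\<close> and
  \<open>b\<close>.\<close>

lemma copying_map_not_unique:
  fixes F :: "(nat \<Rightarrow> 'a::{finite, discrete_topology}) \<Rightarrow> nat \<Rightarrow> 'a"
  assumes F: "F \<in> copying_maps" and ab: "(a :: 'a) \<noteq> b"
  shows "0 \<notin> Uni F"
proof -
  obtain j where j: "\<And>x. F x j = x j" and cont: "F \<in> continuous_maps"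
    using F by (auto simp: copying_maps_def)
  interpret perturbed_map F 0 using cont by unfold_locales simp_all
  let ?f = "\<lambda>x :: nat \<Rightarrow> 'a. of_bool (x j = a) :: real"
  have "P ?f = ?f"
    by (auto simp: fun_eq_iff P_letter noise_def j)
  then have Pn: "(P ^^ t) ?f = ?f" for t
    by (induction t) simp_all
  show ?thesis
  proof (rule not_uniquely_ergodic)
    show "depends_on {j} ?f" by (rule depends_onI) simp
    show "(P ^^ t) ?f (\<lambda>_. b) \<le> 0" "1 \<le> (P ^^ t) ?f (\<lambda>_. a)" for t
      using ab by (simp_all add: Pn)
    show "?f x \<in> {0..1}" for x by simp
  qed simp_all
qed

lemma mixing_maps_unique:
  fixes F :: "(nat \<Rightarrow> 'a::{finite, discrete_topology}) \<Rightarrow> nat \<Rightarrow> 'a"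
  assumes mixing: "\<And>n. F \<in> mixing_maps n" and \<epsilon>: "\<epsilon> \<in> {0<..1}"
  shows "\<epsilon> \<in> Uni F"
proof -
  interpret perturbed_map F \<epsilon>
    using mixing[of 0] \<epsilon> by unfold_locales (auto simp: mixing_maps_def)
  show ?thesis
  proof (rule uniquely_ergodic)
    fix S and f :: "(nat \<Rightarrow> 'a) \<Rightarrow> real"
    assume S: "finite S" and f: "depends_on S f" "\<And>x. f x \<in> {0..1}"
    show "forgets f"
      unfolding forgets_def
    proof (intro allI impI)
      fix \<eta> :: real assume "\<eta> > 0"
      then have "min \<epsilon> \<eta> > 0" using \<epsilon> by simp
      then obtain k where k: "1 / real (Suc k) < min \<epsilon> \<eta>"
        by (rule nat_approx_posE)
      obtain m where m: "S \<subseteq> {..<m}" using S finite_nat_iff_bounded by blast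
      \<comment> \<open>Large enough for three demands: \<open>1 / (n + 1)\<close> is below both
        \<open>\<epsilon>\<close> and \<eta>, and \<open>S\<close> lies among the first
        \<open>n\<close> coordinates.\<close>
      define n where "n = max k m"
      have "1 / real (n + 1) \<le> 1 / real (Suc k)" by (simp add: n_def field_simps)
      then have n: "1 / real (n + 1) \<le> \<epsilon>" "1 / real (n + 1) \<le> \<eta>" using k by auto
      have "depends_on {..<n} f" using f(1) m by (rule depends_on_mono[OF _ order_trans]) (auto simp: n_def)
      then obtain t where "\<And>x y. (P ^^ t) f x - (P ^^ t) f y \<le> 1 / real (n + 1)"
        using mixing[of n] f(2) n(1) \<epsilon> unfolding mixing_maps_def by fastforce
      then show "\<exists>t. \<forall>x y. (P ^^ t) f x - (P ^^ t) f y \<le> \<eta>"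
        using n(2) order_trans by blast
    qed
  qed
qed

lemma Uni_mixing_copying:
  fixes F :: "(nat \<Rightarrow> 'a::{finite, discrete_topology}) \<Rightarrow> nat \<Rightarrow> 'a"
  assumes "F \<in> copying_maps" "\<And>n. F \<in> mixing_maps n" "CARD('a) \<ge> 2"
  shows "Uni F = {0<..1}"
proof -
  have "\<not> card (UNIV :: 'a set) \<le> Suc 0" using assms(3) by simp
  then obtain a b :: 'a where "a \<noteq> b" by (auto simp: card_le_Suc0_iff_eq)
  then have "0 \<notin> Uni F" by (rule copying_map_not_unique[OF assms(1)])
  moreover have "Uni F \<subseteq> {0..1}" by (auto simp: Uni_def)
  moreover have "{0<..1} \<subseteq> Uni F" using mixing_maps_unique[OF assms(2)] by blast
  ultimately show ?thesis by (auto simp: less_le)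
qed

text \<open>Keep the first \<open>n\<close> outputs and copy every other coordinate. All
  sufficiently long heads then form closed finite systems, which contract under noise.\<close>

lemma ex_mixing_copying:
  fixes F :: "(nat \<Rightarrow> 'a::{finite, discrete_topology}) \<Rightarrow> nat \<Rightarrow> 'a"
  assumes F: "F \<in> continuous_maps"
  shows "\<exists>F'. F' \<in> copying_maps \<and> (\<forall>m. F' \<in> mixing_maps m) \<and> (\<forall>x. \<forall>i<n. F' x i = F x i)"
proof -
  obtain M where M: "\<And>i. i < n \<Longrightarrow> depends_on {..<M} (\<lambda>x. F x i)"
    using continuous_map_local[OF F finite_lessThan, of n] by auto
  define F' where "F' x i = (if i < n then F x i else x i)" for x i
  have closed: "depends_on {..<k} (\<lambda>x. F' x i)" if "M \<le> k" "i < k" for i k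
    using M[of i] that by (cases "i < n") (auto simp: F'_def intro: depends_on_coord elim!: depends_on_mono)
  have cont: "F' \<in> continuous_maps"
  proof (rule continuous_mapsI)
    show "\<exists>S. finite S \<and> depends_on S (\<lambda>x. F' x i)" for i
      using closed[of "max M (Suc i)" i] by (intro exI[of _ "{..<max M (Suc i)}"]) auto
  qed
  have "F' \<in> copying_maps"
    using cont by (auto simp: copying_maps_def F'_def intro!: exI[of _ n])
  moreover have "F' \<in> mixing_maps m" for m
  proof -
    define h where "h = max M m"
    \<comment> \<open>The least refresh probability \<open>\<epsilon> ^ h\<close> over the noise
      levels in question, so that one time \<open>t\<close> serves them all.\<close>
    define c where "c = (1 / real (m + 1)) ^ h"
    have c: "0 < c" "c \<le> 1" by (auto simp: c_def power_le_one)
    obtain t where t: "(1 - c) ^ t < 1 / real (m + 1)"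
      using real_arch_pow_inv[of "1 / real (m + 1)" "1 - c"] c by auto
    have "(transfer F' \<epsilon> ^^ t) f x - (transfer F' \<epsilon> ^^ t) f y \<le> 1 / real (m + 1)"
      if \<epsilon>: "\<epsilon> \<in> {1 / real (m + 1)..1}" and f: "depends_on {..<m} f" "\<forall>x. f x \<in> {0..1}" for \<epsilon> f x y
    proof -
      have e: "\<epsilon> \<in> {0..1}" using \<epsilon> order_trans[of 0 "1 / real (m + 1)" \<epsilon>] by simp
      interpret perturbed_map F' \<epsilon> using cont e by unfold_locales
      have "(P ^^ t) f x - (P ^^ t) f y \<le> (1 - \<epsilon> ^ h) ^ t"
        by (rule closed_head_oscillation) (use closed f in \<open>auto simp: h_def elim: depends_on_mono\<close>)
      also have "\<dots> \<le> (1 - c) ^ t"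
        using \<epsilon> e unfolding c_def by (intro power_mono diff_left_mono) (auto simp: power_le_one)
      finally show ?thesis using t by linarith
    qed
    then show ?thesis
      unfolding mixing_maps_def using cont by blast
  qed
  moreover have "\<forall>x. \<forall>i<n. F' x i = F x i" by (simp add: F'_def)
  ultimately show ?thesis by blast
qed

section \<open>From the set of noise levels to the chains\<close>

lemma gdelta_complement_closed:
  fixes G :: "real set"
  assumes "gdelta_in (top_of_set {0..1}) G" "1 \<in> G"
  obtains C where "\<And>n. closed (C n)" "\<And>n. C n \<subseteq> {0..<1}" "G = {0..1} - (\<Union>n::nat. C n)"
proof -
  obtain U where U: "\<And>n::nat. openin (top_of_set {0..1}) (U n)" "\<Inter> (range U) = G"
    using assms(1) unfolding gdelta_in_descending by blast
  define C where "C n = {0..1} - U n" for n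
  have "closed (C n)" for n
  proof -
    obtain T where "open T" "U n = {0..1} \<inter> T" using U(1)[of n] by (auto simp: openin_open)
    then have "C n = {0..1} \<inter> - T" by (auto simp: C_def)
    then show ?thesis using \<open>open T\<close> by (simp add: closed_Int closed_Compl)
  qed
  moreover have "1 \<in> U n" for n using assms(2) U(2) by blast
  then have "C n \<subseteq> {0..<1}" for n by (auto simp: C_def less_le)
  moreover have "U n \<subseteq> {0..1}" for n using openin_imp_subset[OF U(1)] .
  then have "G = {0..1} - (\<Union>n. C n)"
    unfolding U(2)[symmetric] by (fastforce simp: C_def)
  ultimately show thesis by (rule that)
qed

theorem mainTheorem1:
  fixes G :: "real set"
  assumes alphabet: "CARD('a::{finite, discrete_topology}) \<ge> 2"
    and G: "gdelta_in (top_of_set {0..1}) G" "1 \<in> G"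
  shows "(\<exists>F \<in> (continuous_maps :: ((nat \<Rightarrow> 'a) \<Rightarrow> (nat \<Rightarrow> 'a)) set). Uni F = G) \<and>
    dense_in continuous_maps_topology
      {F \<in> (continuous_maps :: ((nat \<Rightarrow> 'a) \<Rightarrow> (nat \<Rightarrow> 'a)) set). Uni F = G - {0}} \<and>
    generic_in continuous_maps_topology
      {F \<in> (continuous_maps :: ((nat \<Rightarrow> 'a) \<Rightarrow> (nat \<Rightarrow> 'a)) set). Uni F = {0<..1}}"
proof (intro conjI)
  have "\<not> card (UNIV :: 'a set) \<le> Suc 0" using alphabet by simp
  then obtain a b :: 'a where ab: "a \<noteq> b" by (auto simp: card_le_Suc0_iff_eq)
  obtain C where C: "\<And>n. closed (C n)" "\<And>n. C n \<subseteq> {0..<1}" and GC: "G = {0..1} - (\<Union>n::nat. C n)"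
    by (rule gdelta_complement_closed[OF G]) blast
  show "\<exists>F \<in> (continuous_maps :: ((nat \<Rightarrow> 'a) \<Rightarrow> (nat \<Rightarrow> 'a)) set). Uni F = G"
  proof -
    \<comment> \<open>With an empty head the prescribed map is irrelevant, and uniqueness at
      \<open>\<epsilon> = 0\<close> remains possible.\<close>
    interpret chain_system "\<lambda>x. x" 0 a b C
      using ab C by unfold_locales (auto intro!: continuous_mapsI depends_on_coord)
    show ?thesis using chain_map_continuous Uni_chain_map GC by blast
  qed
  show "dense_in continuous_maps_topology
      {F \<in> (continuous_maps :: ((nat \<Rightarrow> 'a) \<Rightarrow> (nat \<Rightarrow> 'a)) set). Uni F = G - {0}}"
  proof (rule dense_in_continuous_mapsI)
    fix F :: "(nat \<Rightarrow> 'a) \<Rightarrow> nat \<Rightarrow> 'a" and n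
    assume F: "F \<in> continuous_maps"
    \<comment> \<open>An extra chain with the closed set \<open>{0}\<close> destroys uniqueness at
      0; this permits a head of length \<open>n\<close> copied from \<open>F\<close>.\<close>
    define C' where "C' = case_nat {0} C"
    have C': "closed (C' n)" "C' n \<subseteq> {0..<1}" for n
      using C by (auto simp: C'_def split: nat.split)
    have U: "(\<Union>n. C' n) = insert 0 (\<Union>n. C n)"
      by (auto simp: C'_def split: nat.splits)
    interpret chain_system F n a b C'
      using F ab C' by unfold_locales
    have "Uni chain_map = G - {0}"
      using Uni_chain_map unfolding U GC by blast
    moreover have "\<forall>x. \<forall>i<n. chain_map x i = F x i" by (simp add: chain_map_def)
    ultimately show "\<exists>F'\<in>{F \<in> continuous_maps. Uni F = G - {0}}. \<forall>x. \<forall>i<n. F' x i = F x i"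
      using chain_map_continuous by blast
  qed auto
  show "generic_in continuous_maps_topology
      {F \<in> (continuous_maps :: ((nat \<Rightarrow> 'a) \<Rightarrow> (nat \<Rightarrow> 'a)) set). Uni F = {0<..1}}"
    unfolding generic_in_def
  proof (intro conjI exI)
    \<comment> \<open>A countable intersection of open sets whose members have
      \<open>Uni F = {0<..1}\<close>.\<close>
    let ?D = "copying_maps \<inter> (\<Inter>n. mixing_maps n) :: ((nat \<Rightarrow> 'a) \<Rightarrow> (nat \<Rightarrow> 'a)) set"
    have D: "?D \<subseteq> continuous_maps" by (auto simp: copying_maps_def)
    then show "?D \<subseteq> {F \<in> continuous_maps. Uni F = {0<..1}}"
      using Uni_mixing_copying[OF _ _ alphabet] by blast
    show "gdelta_in continuous_maps_topology ?D"
      by (intro gdelta_in_Int gdelta_in_Inter)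
         (auto intro: open_imp_gdelta_in openin_copying_maps openin_mixing_maps)
    show "dense_in continuous_maps_topology ?D"
    proof (rule dense_in_continuous_mapsI[OF D])
      show "\<exists>F'\<in>?D. \<forall>x. \<forall>i<n. F' x i = F x i" if "F \<in> continuous_maps" for F :: "(nat \<Rightarrow> 'a) \<Rightarrow> nat \<Rightarrow> 'a" and n
        using ex_mixing_copying[OF that, of n] by blast
    qed
  qed auto
qed

end
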